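(* Let $n>1$ and let $L_1,\dots,L_n$ be finitely presented linear orders with $\mathrm{wd}(L_i)=1$ for $1\le i\le n$ and $\mathrm{wd}(L_i+L_{i+1})=2$ for $1\le i<n$. Then $\mathrm{wd}(L_1+L_2+\dots+L_n)=n$.
   Context: $A\times B:=\sum_{a\in A}B$ (lexicographic product, first coordinate dominant); $\omega^*$ is the reverse of $\omega$, $\omega^+:=\omega$, $\omega^-:=\omega^*$, $\omega^0:=\mathbf 1$. Finitely presented linear orders: the smallest class of linear orders closed under isomorphism, containing $\mathbf 0,\mathbf 1$, closed under finite sums and under $L\mapsto\omega\times L$, $L\mapsto\omega^*\times L$. 3-signed trees: a tree is a nonempty finite $T\subseteq\omega^{<\omega}$ closed under initial segments, root $\emptyset$, standard labelling ($\sigma*x\in T$ iff $x<w(T;\sigma)$, where $w(T;\sigma)$ is the number of children of $\sigma$). A 3ST is $(T,s_T)$ with $s_T:T\to\{+,-,0\}$, $s_T(\sigma)=0$ iff $\sigma$ is root or leaf. $\mathrm{LIN}(T,s_T):=\mathbf 0$ if $|T|=1$; otherwise $\mathrm{LIN}(T,s_T,\sigma):=\omega^{s_T(\sigma)}\times\sum_{x<w(T;\sigma)}\mathrm{LIN}(T,s_T,\sigma*x)$ (empty sum $=\mathbf 1$) and $\mathrm{LIN}(T,s_T):=\mathrm{LIN}(T,s_T,\emptyset)$. The width $\mathrm{wd}(L)$ of a finitely presented $L$ is the minimum of $w(T;\emptyset)$ over all 3STs with $\mathrm{LIN}(T,s_T)\cong L$. *)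

theory Defs
  imports Main "HOL-Library.Nat_Bijection" "HOL-Library.Sublist"
begin

text \<open>
  A linear order is a reflexive relation \<^term>\<open>r :: 'a rel\<close> with \<^prop>\<open>Linear_order r\<close>; its
  underlying set is \<^term>\<open>Field r\<close>, so the empty relation is the empty order.
\<close>

definition order_iso :: "'a rel \<Rightarrow> 'b rel \<Rightarrow> bool"  (infix "\<cong>\<^sub>o" 50) where
  "r \<cong>\<^sub>o s \<longleftrightarrow> (\<exists>f. iso r s f)"

definition ordsum :: "'i rel \<Rightarrow> ('i \<Rightarrow> 'a rel) \<Rightarrow> ('i \<times> 'a) rel" where
  "ordsum r L = {((i, a), (j, b)). a \<in> Field (L i) \<and> b \<in> Field (L j) \<and>
     ((i, j) \<in> r \<and> i \<noteq> j \<or> i \<in> Field r \<and> i = j \<and> (a, b) \<in> L i)}"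

text \<open>The product is \<open>\<Sum>\<^bsub>a\<in>A\<^esub> B\<close>, so the left factor is dominant and \<open>\<omega> \<times> B\<close> is
  \<open>\<omega>\<close> many copies of \<open>B\<close>.\<close>

definition ordprod :: "'a rel \<Rightarrow> 'b rel \<Rightarrow> ('a \<times> 'b) rel"  (infixr "\<times>\<^sub>o" 80) where
  "A \<times>\<^sub>o B = ordsum A (\<lambda>_. B)"

text \<open>Sum over a set of natural numbers in increasing order: \<open>natsum {1..n} L\<close> is
  \<open>L\<^sub>1 + \<dots> + L\<^sub>n\<close> and \<open>natsum {i..i+1} L\<close> is \<open>L\<^sub>i + L\<^sub>i\<^sub>+\<^sub>1\<close>.\<close>

definition natsum :: "nat set \<Rightarrow> (nat \<Rightarrow> 'a rel) \<Rightarrow> (nat \<times> 'a) rel" where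
  "natsum I L = ordsum (Restr natLeq I) L"

definition ord_one :: "nat rel" where
  "ord_one = {(0, 0)}"

text \<open>Sums and products change the type of the elements. To iterate them within one type
  (by induction or recursion), their elements are coded as natural numbers; this yields an
  isomorphic order and loses nothing, since all orders involved are countable.\<close>

definition enc :: "(nat \<times> nat) rel \<Rightarrow> nat rel" where
  "enc r = dir_image r prod_encode"

inductive fp_nat :: "nat rel \<Rightarrow> bool" where
  zero: "fp_nat {}"
| one: "fp_nat ord_one"
| sum: "(\<And>i. i < n \<Longrightarrow> fp_nat (L i)) \<Longrightarrow> fp_nat (enc (natsum {..<n} L))"
| omega: "fp_nat r \<Longrightarrow> fp_nat (enc (natLeq \<times>\<^sub>o r))"
| omega_rev: "fp_nat r \<Longrightarrow> fp_nat (enc (natLeq\<inverse> \<times>\<^sub>o r))"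
| iso: "fp_nat r \<Longrightarrow> r \<cong>\<^sub>o s \<Longrightarrow> fp_nat s"

text \<open>Extension to orders on arbitrary types by isomorphism; the closure properties of the
  class, across types, are proved below.\<close>

definition finitely_presented :: "'a rel \<Rightarrow> bool" where
  "finitely_presented r \<longleftrightarrow> (\<exists>s. fp_nat s \<and> s \<cong>\<^sub>o r)"

definition nchildren :: "nat list set \<Rightarrow> nat list \<Rightarrow> nat" where
  "nchildren T \<sigma> = card {x. \<sigma> @ [x] \<in> T}"

definition is_tree :: "nat list set \<Rightarrow> bool" where
  "is_tree T \<longleftrightarrow> finite T \<and> T \<noteq> {} \<and>
     (\<forall>\<tau>\<in>T. \<forall>\<sigma>. prefix \<sigma> \<tau> \<longrightarrow> \<sigma> \<in> T) \<and>
     (\<forall>\<sigma>\<in>T. \<forall>x. \<sigma> @ [x] \<in> T \<longleftrightarrow> x < nchildren T \<sigma>)"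

datatype sign = Plus | Minus | Zero

text \<open>Only the values of the sign function on \<open>T\<close> matter.\<close>

definition signed_tree3 :: "nat list set \<Rightarrow> (nat list \<Rightarrow> sign) \<Rightarrow> bool" where
  "signed_tree3 T s \<longleftrightarrow> is_tree T \<and>
     (\<forall>\<sigma>\<in>T. s \<sigma> = Zero \<longleftrightarrow> \<sigma> = [] \<or> nchildren T \<sigma> = 0)"

fun omega_pow :: "sign \<Rightarrow> nat rel" where
  "omega_pow Plus = natLeq"
| "omega_pow Minus = natLeq\<inverse>"
| "omega_pow Zero = ord_one"

lemma natsum_cong [fundef_cong]:
  assumes "I = J" "\<And>i. i \<in> J \<Longrightarrow> L i = M i"
  shows "natsum I L = natsum J M"
  using assms unfolding natsum_def ordsum_def Field_def by fastforce

text \<open>The guard only makes the recursion total; the value outside trees is irrelevant.\<close>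

function LIN_at :: "nat list set \<Rightarrow> (nat list \<Rightarrow> sign) \<Rightarrow> nat list \<Rightarrow> nat rel" where
  "LIN_at T s \<sigma> =
     (if is_tree T \<and> \<sigma> \<in> T then
        enc (omega_pow (s \<sigma>) \<times>\<^sub>o
          (if nchildren T \<sigma> = 0 then ord_one
           else enc (natsum {..<nchildren T \<sigma>} (\<lambda>x. LIN_at T s (\<sigma> @ [x])))))
      else {})"
  by pat_completeness auto
termination
proof (relation "measure (\<lambda>(T, s, \<sigma>). card {\<tau> \<in> T. prefix \<sigma> \<tau>})", simp)
  fix T :: "nat list set" and s :: "nat list \<Rightarrow> sign" and \<sigma> :: "nat list" and x
  assume *: "is_tree T \<and> \<sigma> \<in> T" and "x \<in> {..<nchildren T \<sigma>}"
  have "{\<tau> \<in> T. prefix (\<sigma> @ [x]) \<tau>} \<subseteq> {\<tau> \<in> T. prefix \<sigma> \<tau>}"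
    by (auto dest: append_prefixD)
  moreover have "\<sigma> \<in> {\<tau> \<in> T. prefix \<sigma> \<tau>} - {\<tau> \<in> T. prefix (\<sigma> @ [x]) \<tau>}"
    using * by simp
  ultimately have "{\<tau> \<in> T. prefix (\<sigma> @ [x]) \<tau>} \<subset> {\<tau> \<in> T. prefix \<sigma> \<tau>}"
    by blast
  then show "((T, s, \<sigma> @ [x]), T, s, \<sigma>)
      \<in> measure (\<lambda>(T, s, \<sigma>). card {\<tau> \<in> T. prefix \<sigma> \<tau>})"
    using * by (auto simp: is_tree_def intro: psubset_card_mono)
qed

declare LIN_at.simps [simp del]

definition LIN :: "nat list set \<Rightarrow> (nat list \<Rightarrow> sign) \<Rightarrow> nat rel" where
  "LIN T s = (if card T = 1 then {} else LIN_at T s [])"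

text \<open>Meaningful for orders isomorphic to some \<open>LIN T s\<close>, in particular the finitely
  presented ones.\<close>

definition wd :: "'a rel \<Rightarrow> nat" where
  "wd r = (LEAST k. \<exists>T s. signed_tree3 T s \<and> LIN T s \<cong>\<^sub>o r \<and> k = nchildren T [])"

lemma order_iso_iff:
  "r \<cong>\<^sub>o s \<longleftrightarrow> (\<exists>f. bij_betw f (Field r) (Field s) \<and>
     (\<forall>a\<in>Field r. \<forall>b\<in>Field r. (a, b) \<in> r \<longleftrightarrow> (f a, f b) \<in> s))"
  unfolding order_iso_def by (rule ex_cong1) (rule iso_iff2)

lemma order_iso_refl: "r \<cong>\<^sub>o r"
  unfolding order_iso_def using id_iso by blast

lemma order_iso_sym:
  assumes "r \<cong>\<^sub>o s" shows "s \<cong>\<^sub>o r"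
proof -
  obtain f where f: "bij_betw f (Field r) (Field s)"
    "\<And>a b. a \<in> Field r \<Longrightarrow> b \<in> Field r \<Longrightarrow> (a, b) \<in> r \<longleftrightarrow> (f a, f b) \<in> s"
    using assms unfolding order_iso_iff by blast
  let ?g = "inv_into (Field r) f"
  have g: "?g a \<in> Field r" "f (?g a) = a" if "a \<in> Field s" for a
    using f(1) that by (auto simp: bij_betw_def inv_into_into f_inv_into_f)
  show ?thesis unfolding order_iso_iff
    by (rule exI[of _ ?g]) (simp add: bij_betw_inv_into f g)
qed

lemma order_iso_trans:
  assumes "r \<cong>\<^sub>o s" "s \<cong>\<^sub>o t" shows "r \<cong>\<^sub>o t"
proof -
  obtain f where f: "bij_betw f (Field r) (Field s)"
    "\<And>a b. a \<in> Field r \<Longrightarrow> b \<in> Field r \<Longrightarrow> (a, b) \<in> r \<longleftrightarrow> (f a, f b) \<in> s"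
    using assms(1) unfolding order_iso_iff by blast
  obtain g where g: "bij_betw g (Field s) (Field t)"
    "\<And>a b. a \<in> Field s \<Longrightarrow> b \<in> Field s \<Longrightarrow> (a, b) \<in> s \<longleftrightarrow> (g a, g b) \<in> t"
    using assms(2) unfolding order_iso_iff by blast
  have "f a \<in> Field s" if "a \<in> Field r" for a
    using f(1) that by (auto simp: bij_betw_def)
  then show ?thesis unfolding order_iso_iff
    by (intro exI[of _ "g \<circ> f"]) (simp add: bij_betw_trans[OF f(1) g(1)] f g)
qed

lemma order_iso_enc: "r \<cong>\<^sub>o enc r"
proof -
  have "(prod_encode p, prod_encode q) \<in> dir_image r prod_encode \<longleftrightarrow> (p, q) \<in> r" for p q
    unfolding dir_image_def by (cases p; cases q) (simp add: prod_encode_eq)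
  then show ?thesis
    unfolding order_iso_iff enc_def
    by (intro exI[of _ prod_encode])
       (simp add: bij_betw_def dir_image_Field inj_prod_encode)
qed

lemma Field_ordsum:
  assumes "Refl r" "\<And>i. i \<in> Field r \<Longrightarrow> Refl (L i)"
  shows "Field (ordsum r L) = Sigma (Field r) (\<lambda>i. Field (L i))"
proof (intro equalityI subsetI)
  fix p assume "p \<in> Field (ordsum r L)"
  then show "p \<in> Sigma (Field r) (\<lambda>i. Field (L i))"
    by (auto simp: ordsum_def Field_def)
next
  fix p assume "p \<in> Sigma (Field r) (\<lambda>i. Field (L i))"
  then have "(p, p) \<in> ordsum r L"
    using assms by (auto simp: ordsum_def dest: refl_onD)
  then show "p \<in> Field (ordsum r L)" by (auto simp: Field_def)
qed

lemma Linear_order_ordsum: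
  assumes "Linear_order r" "\<And>i. i \<in> Field r \<Longrightarrow> Linear_order (L i)"
  shows "Linear_order (ordsum r L)"
proof -
  have R: "Refl r" "trans r" "antisym r" "Total r"
    using assms(1) by (auto simp: order_on_defs)
  have L: "Refl (L i)" "trans (L i)" "antisym (L i)" "Total (L i)" if "i \<in> Field r" for i
    using assms(2)[OF that] by (auto simp: order_on_defs)
  have F: "Field (ordsum r L) = Sigma (Field r) (\<lambda>i. Field (L i))"
    using Field_ordsum R(1) L(1) by blast
  have "Refl (ordsum r L)"
    unfolding F by (rule refl_onI) (use R(1) L(1) in \<open>auto simp: ordsum_def dest: refl_onD\<close>)
  moreover have "trans (ordsum r L)"
  proof (rule transI)
    fix p q t assume *: "(p, q) \<in> ordsum r L" "(q, t) \<in> ordsum r L"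
    obtain i a j b k c where pqt: "p = (i, a)" "q = (j, b)" "t = (k, c)"
      by (metis surj_pair)
    have ab: "a \<in> Field (L i)" "c \<in> Field (L k)"
      and 1: "(i, j) \<in> r \<and> i \<noteq> j \<or> i \<in> Field r \<and> i = j \<and> (a, b) \<in> L i"
      and 2: "(j, k) \<in> r \<and> j \<noteq> k \<or> j \<in> Field r \<and> j = k \<and> (b, c) \<in> L j"
      using * unfolding pqt ordsum_def by blast+
    have "(i, k) \<in> r \<and> i \<noteq> k \<or> i \<in> Field r \<and> i = k \<and> (a, c) \<in> L i"
      using 1 2 transD[OF R(2), of i j k] antisymD[OF R(3), of i j] transD[OF L(2), of i a b c]
      by blast
    then show "(p, t) \<in> ordsum r L"
      using ab unfolding pqt ordsum_def by blast
  qed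
  moreover have "antisym (ordsum r L)"
  proof (rule antisymI)
    fix p q assume *: "(p, q) \<in> ordsum r L" "(q, p) \<in> ordsum r L"
    obtain i a j b where pq: "p = (i, a)" "q = (j, b)" by (metis surj_pair)
    have 1: "(i, j) \<in> r \<and> i \<noteq> j \<or> i \<in> Field r \<and> i = j \<and> (a, b) \<in> L i"
      and 2: "(j, i) \<in> r \<and> j \<noteq> i \<or> j \<in> Field r \<and> j = i \<and> (b, a) \<in> L j"
      using * unfolding pq ordsum_def by blast+
    then show "p = q"
      using antisymD[OF R(3), of i j] antisymD[OF L(3), of i a b] unfolding pq by blast
  qed
  moreover have "Total (ordsum r L)"
    unfolding F
  proof (rule total_onI)
    fix p q assume *: "p \<in> Sigma (Field r) (\<lambda>i. Field (L i))"
      "q \<in> Sigma (Field r) (\<lambda>i. Field (L i))" "p \<noteq> q"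
    obtain i a j b where pq: "p = (i, a)" "q = (j, b)" by (metis surj_pair)
    have mem: "i \<in> Field r" "j \<in> Field r" "a \<in> Field (L i)" "b \<in> Field (L j)"
      using * unfolding pq by blast+
    show "(p, q) \<in> ordsum r L \<or> (q, p) \<in> ordsum r L"
    proof (cases "i = j")
      case True
      then have "(a, b) \<in> L i \<or> (b, a) \<in> L i"
        using *(3) mem L(4)[of i] unfolding pq total_on_def by blast
      then show ?thesis using True mem unfolding pq ordsum_def by blast
    next
      case False
      then have "(i, j) \<in> r \<or> (j, i) \<in> r"
        using mem R(4) unfolding total_on_def by blast
      then show ?thesis using False mem unfolding pq ordsum_def by blast
    qed
  qed
  moreover have "ordsum r L \<subseteq> Field (ordsum r L) \<times> Field (ordsum r L)"
    by (auto simp: Field_def)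
  ultimately show ?thesis
    unfolding order_on_defs by blast
qed

lemma ordsum_iso:
  assumes "Refl r" "\<And>i. i \<in> Field r \<Longrightarrow> Refl (L i)" "\<And>i. i \<in> Field r \<Longrightarrow> Refl (M i)"
    and iso: "\<And>i. i \<in> Field r \<Longrightarrow> L i \<cong>\<^sub>o M i"
  shows "ordsum r L \<cong>\<^sub>o ordsum r M"
proof -
  have "\<forall>i\<in>Field r. \<exists>f. bij_betw f (Field (L i)) (Field (M i)) \<and>
     (\<forall>a\<in>Field (L i). \<forall>b\<in>Field (L i). (a, b) \<in> L i \<longleftrightarrow> (f a, f b) \<in> M i)"
    using iso unfolding order_iso_iff by blast
  then obtain f where f: "\<And>i. i \<in> Field r \<Longrightarrow> bij_betw (f i) (Field (L i)) (Field (M i))"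
    "\<And>i a b. i \<in> Field r \<Longrightarrow> a \<in> Field (L i) \<Longrightarrow> b \<in> Field (L i) \<Longrightarrow>
       (a, b) \<in> L i \<longleftrightarrow> (f i a, f i b) \<in> M i"
    by (metis (no_types, lifting) bchoice)
  let ?h = "\<lambda>(i, a). (i, f i a)"
  have F: "Field (ordsum r L) = Sigma (Field r) (\<lambda>i. Field (L i))"
    "Field (ordsum r M) = Sigma (Field r) (\<lambda>i. Field (M i))"
    using assms by (auto simp: Field_ordsum)
  have fin: "f i a \<in> Field (M i)" if "i \<in> Field r" "a \<in> Field (L i)" for i a
    using f(1) that by (auto simp: bij_betw_def)
  have "inj_on ?h (Sigma (Field r) (\<lambda>i. Field (L i)))"
    using f(1) by (auto simp: inj_on_def bij_betw_def)
  moreover have "?h ` Sigma (Field r) (\<lambda>i. Field (L i)) = Sigma (Field r) (\<lambda>i. Field (M i))"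
  proof (intro equalityI subsetI)
    fix p assume "p \<in> Sigma (Field r) (\<lambda>i. Field (M i))"
    then obtain i b where p: "p = (i, b)" "i \<in> Field r" "b \<in> Field (M i)" by blast
    then obtain a where "a \<in> Field (L i)" "b = f i a"
      using f(1) unfolding bij_betw_def by blast
    then show "p \<in> ?h ` Sigma (Field r) (\<lambda>i. Field (L i))"
      using p by force
  qed (use fin in auto)
  ultimately have "bij_betw ?h (Field (ordsum r L)) (Field (ordsum r M))"
    unfolding F bij_betw_def by blast
  moreover have "(p, q) \<in> ordsum r L \<longleftrightarrow> (?h p, ?h q) \<in> ordsum r M"
    if "p \<in> Field (ordsum r L)" "q \<in> Field (ordsum r L)" for p q
    using that unfolding F by (auto simp: ordsum_def fin f(2))
  ultimately show ?thesis unfolding order_iso_iff by blast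
qed

lemma Linear_order_order_iso:
  assumes "Linear_order r" "r \<cong>\<^sub>o s" shows "Linear_order s"
proof -
  obtain f where f: "bij_betw f (Field s) (Field r)"
    "\<And>a b. a \<in> Field s \<Longrightarrow> b \<in> Field s \<Longrightarrow> (a, b) \<in> s \<longleftrightarrow> (f a, f b) \<in> r"
    using order_iso_sym[OF assms(2)] unfolding order_iso_iff by blast
  have R: "Refl r" "trans r" "antisym r" "Total r"
    using assms(1) by (auto simp: order_on_defs)
  have fin: "f a \<in> Field r" if "a \<in> Field s" for a
    using f(1) that by (auto simp: bij_betw_def)
  have inj: "a = b" if "f a = f b" "a \<in> Field s" "b \<in> Field s" for a b
    using f(1) that by (auto simp: bij_betw_def inj_on_def)
  have Fs: "a \<in> Field s \<and> b \<in> Field s" if "(a, b) \<in> s" for a b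
    using that by (auto simp: Field_def)
  have "Refl s"
    by (rule refl_onI) (use R(1) fin f(2) in \<open>auto dest: refl_onD\<close>)
  moreover have "trans s"
    by (rule transI) (metis Fs f(2) R(2) transD)
  moreover have "antisym s"
    by (rule antisymI) (metis Fs f(2) R(3) antisymD inj)
  moreover have "Total s"
    using R(4) fin f(2) inj unfolding total_on_def by metis
  ultimately show ?thesis by (auto simp: order_on_defs Fs)
qed

lemma Linear_order_natLeq: "Linear_order natLeq"
  by (auto simp: natLeq_Linear_order)

lemma Linear_order_Restr_natLeq: "Linear_order (Restr natLeq I)"
  by (simp add: Linear_order_Restr natLeq_Linear_order)

lemma Field_Restr_natLeq: "Field (Restr natLeq I) = I"
  by (auto simp: Field_def natLeq_def)

lemma fp_nat_Linear_order: "fp_nat r \<Longrightarrow> Linear_order r"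
proof (induction rule: fp_nat.induct)
  case zero
  then show ?case by (simp add: order_on_defs refl_on_def total_on_def)
next
  case one
  then show ?case
    by (auto simp: ord_one_def order_on_defs refl_on_def total_on_def trans_def antisym_def Field_def)
next
  case (sum n L)
  have "Linear_order (natsum {..<n} L)"
    unfolding natsum_def
    by (rule Linear_order_ordsum[OF Linear_order_Restr_natLeq]) (use sum in \<open>auto simp: Field_Restr_natLeq\<close>)
  then show ?case by (rule Linear_order_order_iso[OF _ order_iso_enc])
next
  case (omega r)
  have "Linear_order (natLeq \<times>\<^sub>o r)"
    unfolding ordprod_def by (rule Linear_order_ordsum[OF Linear_order_natLeq omega.IH])
  then show ?case by (rule Linear_order_order_iso[OF _ order_iso_enc])
next
  case (omega_rev r)
  have "Linear_order (natLeq\<inverse> \<times>\<^sub>o r)"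
    unfolding ordprod_def
    by (rule Linear_order_ordsum) (simp_all add: natLeq_Linear_order omega_rev.IH)
  then show ?case by (rule Linear_order_order_iso[OF _ order_iso_enc])
next
  case (iso r s)
  then show ?case using Linear_order_order_iso by blast
qed

lemma finitely_presented_Linear_order: "finitely_presented r \<Longrightarrow> Linear_order r"
  unfolding finitely_presented_def
  using fp_nat_Linear_order Linear_order_order_iso by blast

lemma finitely_presented_Refl: "finitely_presented r \<Longrightarrow> Refl r"
  using finitely_presented_Linear_order by (auto simp: order_on_defs)

lemma fp_nat_Refl: "fp_nat r \<Longrightarrow> Refl r"
  using fp_nat_Linear_order by (auto simp: order_on_defs)

lemma finitely_presented_iso:
  "finitely_presented r \<Longrightarrow> r \<cong>\<^sub>o s \<Longrightarrow> finitely_presented s"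
  unfolding finitely_presented_def using order_iso_trans by blast

lemma finitely_presented_nat_iff: "finitely_presented r \<longleftrightarrow> fp_nat r"
  unfolding finitely_presented_def using fp_nat.iso order_iso_refl by blast

lemma finitely_presented_zero: "finitely_presented {}"
proof -
  have "({} :: nat rel) \<cong>\<^sub>o ({} :: 'a rel)" by (simp add: order_iso_iff bij_betw_def)
  then show ?thesis unfolding finitely_presented_def using fp_nat.zero by blast
qed

lemma finitely_presented_one: "finitely_presented {(x, x)}"
proof -
  have "ord_one \<cong>\<^sub>o {(x, x)}"
    unfolding order_iso_iff ord_one_def by (rule exI[of _ "\<lambda>_. x"]) (auto simp: bij_betw_def Field_def)
  then show ?thesis unfolding finitely_presented_def using fp_nat.one by blast
qed

lemma finitely_presented_natsum:
  assumes "\<And>i. i < n \<Longrightarrow> finitely_presented (L i)"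
  shows "finitely_presented (natsum {..<n} L)"
proof -
  have "\<forall>i\<in>{..<n}. \<exists>s. fp_nat s \<and> s \<cong>\<^sub>o L i"
    using assms unfolding finitely_presented_def by blast
  then obtain M where M: "\<And>i. i < n \<Longrightarrow> fp_nat (M i)" "\<And>i. i < n \<Longrightarrow> M i \<cong>\<^sub>o L i"
    by (metis lessThan_iff)
  have "Refl (Restr natLeq {..<n})"
    using Linear_order_Restr_natLeq unfolding order_on_defs by blast
  then have "natsum {..<n} M \<cong>\<^sub>o natsum {..<n} L"
    unfolding natsum_def
    by (rule ordsum_iso)
       (simp_all add: Field_Restr_natLeq M assms fp_nat_Refl finitely_presented_Refl)
  then have "enc (natsum {..<n} M) \<cong>\<^sub>o natsum {..<n} L"
    using order_iso_trans order_iso_sym order_iso_enc by blast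
  then show ?thesis
    unfolding finitely_presented_def using fp_nat.sum M(1) by blast
qed

lemma finitely_presented_prod:
  assumes "finitely_presented r"
  shows "finitely_presented (natLeq \<times>\<^sub>o r)" "finitely_presented (natLeq\<inverse> \<times>\<^sub>o r)"
proof -
  obtain s where s: "fp_nat s" "s \<cong>\<^sub>o r"
    using assms unfolding finitely_presented_def by blast
  have "q \<times>\<^sub>o s \<cong>\<^sub>o q \<times>\<^sub>o r" if "Refl q" for q :: "nat rel"
    unfolding ordprod_def
    by (rule ordsum_iso[OF that])
       (simp_all add: s assms fp_nat_Refl finitely_presented_Refl)
  then have *: "enc (q \<times>\<^sub>o s) \<cong>\<^sub>o q \<times>\<^sub>o r" if "Refl q" for q :: "nat rel"
    using that order_iso_trans order_iso_sym order_iso_enc by blast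
  show "finitely_presented (natLeq \<times>\<^sub>o r)"
    unfolding finitely_presented_def using fp_nat.omega[OF s(1)] *[OF natLeq_Refl] by blast
  have "Refl (natLeq\<inverse>)" using natLeq_Refl by simp
  then show "finitely_presented (natLeq\<inverse> \<times>\<^sub>o r)"
    unfolding finitely_presented_def using fp_nat.omega_rev[OF s(1)] * by blast
qed

end

theory Submission
  imports Defs "HOL-Library.Countable_Set"
begin

text \<open>
  Order types of countable linear orders form a monoid in which any two decompositions
  \<open>a + b = c + d\<close> have a common refinement. Width \<open>1\<close> means being an atom: \<open>1\<close>, \<open>\<omega> \<times> x\<close> or
  \<open>\<omega>\<^sup>* \<times> x\<close> with \<open>x \<noteq> 0\<close>; the width is the least number of atoms with the given sum. Three
  facts control how two atoms can overlap: nonempty final segments of an \<open>\<omega>\<close>-atom are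
  \<open>\<omega>\<close>-atoms; if \<open>a + x\<close> and \<open>x + b\<close> are \<open>\<omega>\<close>-atoms with \<open>x \<noteq> 0\<close>, then so is \<open>a + x + b\<close>; and
  nothing is both an \<open>\<omega>\<close>-atom and an \<open>\<omega>\<^sup>*\<close>-atom. By comparing first summands, they imply that
  two decompositions into atoms in which no two neighbours merge into an atom have the same
  length. A decomposition of least length has this property, and the given one has it by
  hypothesis.
\<close>

section \<open>Countable linear orders and their isomorphisms\<close>

definition ctbl_order :: "'a rel \<Rightarrow> bool" where
  "ctbl_order r \<longleftrightarrow> Linear_order r \<and> countable (Field r)"

text \<open>Totality of \<open>r\<close> and antisymmetry of \<open>s\<close> make a strictly
  increasing map injective and order-reflecting, so later isomorphisms only need surjectivity and
  strict monotonicity.\<close>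

lemma order_isoI:
  assumes "ctbl_order r" "ctbl_order s" "f ` Field r = Field s"
    and mono: "\<And>a b. (a, b) \<in> r \<Longrightarrow> a \<noteq> b \<Longrightarrow> (f a, f b) \<in> s \<and> f a \<noteq> f b"
  shows "r \<cong>\<^sub>o s"
proof -
  have R: "Refl r" "antisym r" "Total r" and S: "Refl s" "antisym s"
    using assms(1,2) by (auto simp: ctbl_order_def order_on_defs)
  have inj: "inj_on f (Field r)"
    using R(3) mono unfolding inj_on_def total_on_def by metis
  have "(a, b) \<in> r \<longleftrightarrow> (f a, f b) \<in> s" if ab: "a \<in> Field r" "b \<in> Field r" for a b
  proof (cases "a = b")
    case True
    then show ?thesis
      using ab R(1) S(1) assms(3) by (auto dest: refl_onD)
  next
    case False
    then show ?thesis
      using ab R(3) mono[of a b] mono[of b a] S(2) unfolding total_on_def antisym_def by metis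
  qed
  then show ?thesis
    using inj assms(3) unfolding order_iso_iff bij_betw_def by blast
qed

lemma order_isoE:
  assumes "r \<cong>\<^sub>o s"
  obtains f where "f ` Field r = Field s"
    "\<And>a b. (a, b) \<in> r \<Longrightarrow> a \<noteq> b \<Longrightarrow> (f a, f b) \<in> s \<and> f a \<noteq> f b"
proof -
  obtain f where f: "bij_betw f (Field r) (Field s)"
    "\<And>a b. a \<in> Field r \<Longrightarrow> b \<in> Field r \<Longrightarrow> (a, b) \<in> r \<longleftrightarrow> (f a, f b) \<in> s"
    using assms unfolding order_iso_iff by blast
  have "(f a, f b) \<in> s \<and> f a \<noteq> f b" if "(a, b) \<in> r" "a \<noteq> b" for a b
    using f that FieldI1[OF that(1)] FieldI2[OF that(1)] by (metis bij_betw_def inj_onD)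
  then show thesis
    using that f(1) by (metis bij_betw_def)
qed

lemma ctbl_order_imp_Linear_order: "ctbl_order r \<Longrightarrow> Linear_order r"
  by (simp add: ctbl_order_def)

lemma ctbl_order_imp_Refl: "ctbl_order r \<Longrightarrow> Refl r"
  by (simp add: ctbl_order_def order_on_defs)

lemma ctbl_order_nat: "Linear_order (r :: nat rel) \<Longrightarrow> ctbl_order r"
  by (simp add: ctbl_order_def)

lemma ctbl_order_ordsum:
  assumes "ctbl_order r" "\<And>i. i \<in> Field r \<Longrightarrow> ctbl_order (L i)"
  shows "ctbl_order (ordsum r L)"
  unfolding ctbl_order_def
proof
  show "Linear_order (ordsum r L)"
    using assms by (intro Linear_order_ordsum) (auto simp: ctbl_order_def)
  show "countable (Field (ordsum r L))"
    using assms by (subst Field_ordsum) (auto simp: ctbl_order_def order_on_defs)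
qed

lemma ctbl_order_ordprod: "ctbl_order r \<Longrightarrow> ctbl_order s \<Longrightarrow> ctbl_order (r \<times>\<^sub>o s)"
  unfolding ordprod_def by (simp add: ctbl_order_ordsum)

lemma ctbl_order_natsum: "(\<And>i. i \<in> I \<Longrightarrow> ctbl_order (L i)) \<Longrightarrow> ctbl_order (natsum I L)"
  unfolding natsum_def
  using ctbl_order_nat[OF Linear_order_Restr_natLeq]
  by (rule ctbl_order_ordsum) (simp add: Field_Restr_natLeq)

lemma ctbl_order_converse: "ctbl_order r \<Longrightarrow> ctbl_order (r\<inverse>)"
  by (simp add: ctbl_order_def)

lemma ctbl_order_Restr: "ctbl_order r \<Longrightarrow> ctbl_order (Restr r A)"
  unfolding ctbl_order_def
  using Linear_order_Restr Field_Restr_subset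
  by (metis Int_lower1 countable_subset mono_Field)

lemma ctbl_order_iso: "ctbl_order r \<Longrightarrow> r \<cong>\<^sub>o s \<Longrightarrow> ctbl_order s"
  unfolding ctbl_order_def
  by (metis Linear_order_order_iso bij_betw_def countable_image order_iso_iff)

lemma ctbl_order_natLeq: "ctbl_order natLeq"
  by (simp add: ctbl_order_nat Linear_order_natLeq)

text \<open>An injection of the field into \<open>nat\<close> transports the order. Thus orders on
  arbitrary types can be compared within the single type \<open>nat rel\<close>.\<close>

lemma ctbl_order_nat_copy:
  assumes "ctbl_order r"
  obtains t :: "nat rel" where "Linear_order t" "t \<cong>\<^sub>o r"
proof -
  obtain f :: "'a \<Rightarrow> nat" where f: "inj_on f (Field r)"
    using assms unfolding ctbl_order_def countable_def by blast
  have "(f a, f b) \<in> dir_image r f \<longleftrightarrow> (a, b) \<in> r" if "a \<in> Field r" "b \<in> Field r" for a b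
  proof
    assume "(f a, f b) \<in> dir_image r f"
    then obtain a' b' where "f a = f a'" "f b = f b'" "(a', b') \<in> r"
      unfolding dir_image_def by blast
    then show "(a, b) \<in> r"
      using f that by (metis FieldI1 FieldI2 inj_onD)
  qed (auto simp: dir_image_def)
  then have iso: "r \<cong>\<^sub>o dir_image r f"
    using f unfolding order_iso_iff by (intro exI[of _ f]) (simp add: bij_betw_def dir_image_Field)
  then show thesis
    using that assms Linear_order_order_iso order_iso_sym by (metis ctbl_order_def)
qed

subsection \<open>Binary sums\<close>

text \<open>Unlike \<open>natsum\<close>, this allows summands with different element types.\<close>

definition bsum :: "'a rel \<Rightarrow> 'b rel \<Rightarrow> ('a + 'b) rel" where
  "bsum r s = {(Inl a, Inl b) | a b. (a, b) \<in> r} \<union> {(Inr a, Inr b) | a b. (a, b) \<in> s}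
     \<union> {(Inl a, Inr b) | a b. a \<in> Field r \<and> b \<in> Field s}"

lemma bsum_simps [simp]:
  "(Inl a, Inl a') \<in> bsum r s \<longleftrightarrow> (a, a') \<in> r"
  "(Inr b, Inr b') \<in> bsum r s \<longleftrightarrow> (b, b') \<in> s"
  "(Inl a, Inr b) \<in> bsum r s \<longleftrightarrow> a \<in> Field r \<and> b \<in> Field s"
  "(Inr b, Inl a) \<notin> bsum r s"
  by (auto simp: bsum_def)

lemma Field_bsum: "Field (bsum r s) = Field r <+> Field s"
proof (intro equalityI subsetI)
  fix x assume "x \<in> Field (bsum r s)"
  then show "x \<in> Field r <+> Field s"
    by (auto simp: bsum_def Field_def)
next
  fix x assume "x \<in> Field r <+> Field s"
  then show "x \<in> Field (bsum r s)"
  proof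
    fix a assume x: "x = Inl a" "a \<in> Field r"
    then obtain b where "(x, Inl b) \<in> bsum r s \<or> (Inl b, x) \<in> bsum r s"
      by (auto simp: Field_def)
    then show ?thesis by (auto simp: Field_def)
  next
    fix a assume x: "x = Inr a" "a \<in> Field s"
    then obtain b where "(x, Inr b) \<in> bsum r s \<or> (Inr b, x) \<in> bsum r s"
      by (auto simp: Field_def)
    then show ?thesis by (auto simp: Field_def)
  qed
qed

lemma Linear_order_bsum:
  assumes "Linear_order r" "Linear_order s"
  shows "Linear_order (bsum r s)"
proof -
  have R: "Refl r" "trans r" "antisym r" "Total r"
    and S: "Refl s" "trans s" "antisym s" "Total s"
    using assms by (auto simp: order_on_defs)
  have "Refl (bsum r s)"
    using R(1) S(1) by (auto simp: refl_on_def Field_bsum)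
  moreover have "trans (bsum r s)"
  proof (rule transI)
    fix x y z assume "(x, y) \<in> bsum r s" "(y, z) \<in> bsum r s"
    then show "(x, z) \<in> bsum r s"
      using R(2) S(2)
      by (cases x; cases y; cases z) (auto dest: transD FieldI1 FieldI2)
  qed
  moreover have "antisym (bsum r s)"
  proof (rule antisymI)
    fix x y assume "(x, y) \<in> bsum r s" "(y, x) \<in> bsum r s"
    then show "x = y"
      using R(3) S(3) by (cases x; cases y) (auto dest: antisymD)
  qed
  moreover have "Total (bsum r s)"
    unfolding Field_bsum
  proof (rule total_onI)
    fix x y assume "x \<in> Field r <+> Field s" "y \<in> Field r <+> Field s" "x \<noteq> y"
    then show "(x, y) \<in> bsum r s \<or> (y, x) \<in> bsum r s"
      using R(4) S(4) unfolding total_on_def by (cases x; cases y) (simp_all; blast)+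
  qed
  moreover have "bsum r s \<subseteq> Field (bsum r s) \<times> Field (bsum r s)"
    by (auto simp: Field_def)
  ultimately show ?thesis by (auto simp: order_on_defs)
qed

lemma ctbl_order_bsum: "ctbl_order r \<Longrightarrow> ctbl_order s \<Longrightarrow> ctbl_order (bsum r s)"
  unfolding ctbl_order_def using Linear_order_bsum[of r s] by (metis Field_bsum countable_Plus)

lemma bsum_iso:
  assumes "ctbl_order r" "ctbl_order s" "ctbl_order r'" "ctbl_order s'" "r \<cong>\<^sub>o r'" "s \<cong>\<^sub>o s'"
  shows "bsum r s \<cong>\<^sub>o bsum r' s'"
proof -
  obtain f where f: "f ` Field r = Field r'"
    "\<And>a b. (a, b) \<in> r \<Longrightarrow> a \<noteq> b \<Longrightarrow> (f a, f b) \<in> r' \<and> f a \<noteq> f b"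
    using order_isoE[OF assms(5)] by metis
  obtain g where g: "g ` Field s = Field s'"
    "\<And>a b. (a, b) \<in> s \<Longrightarrow> a \<noteq> b \<Longrightarrow> (g a, g b) \<in> s' \<and> g a \<noteq> g b"
    using order_isoE[OF assms(6)] by metis
  show ?thesis
  proof (rule order_isoI[where f = "map_sum f g"])
    show "map_sum f g ` Field (bsum r s) = Field (bsum r' s')"
      unfolding Field_bsum f(1)[symmetric] g(1)[symmetric] Plus_def image_Un image_image by simp
    fix x y assume "(x, y) \<in> bsum r s" "x \<noteq> y"
    then show "(map_sum f g x, map_sum f g y) \<in> bsum r' s' \<and> map_sum f g x \<noteq> map_sum f g y"
      using f g by (cases x; cases y) auto
  qed (intro ctbl_order_bsum assms(1-4))+
qed

lemma mem_ordprod: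
  "((i, a), (j, b)) \<in> r \<times>\<^sub>o s \<longleftrightarrow> a \<in> Field s \<and> b \<in> Field s \<and>
     ((i, j) \<in> r \<and> i \<noteq> j \<or> i \<in> Field r \<and> i = j \<and> (a, b) \<in> s)"
  by (auto simp: ordprod_def ordsum_def)

lemma Field_ordprod: "Refl r \<Longrightarrow> Refl s \<Longrightarrow> Field (r \<times>\<^sub>o s) = Field r \<times> Field s"
  unfolding ordprod_def by (simp add: Field_ordsum)

lemma ordprod_iso:
  assumes "Refl q" "Refl r" "Refl s" "r \<cong>\<^sub>o s"
  shows "q \<times>\<^sub>o r \<cong>\<^sub>o q \<times>\<^sub>o s"
  unfolding ordprod_def using assms by (intro ordsum_iso)

lemma converse_iso: "r \<cong>\<^sub>o s \<Longrightarrow> r\<inverse> \<cong>\<^sub>o s\<inverse>"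
  unfolding order_iso_iff by auto

lemma natLeq_iff [simp]: "(i, j) \<in> natLeq \<longleftrightarrow> i \<le> j"
  by (simp add: natLeq_def)

declare Field_natLeq [simp]

lemma bsum_assoc:
  assumes "ctbl_order r" "ctbl_order s" "ctbl_order t"
  shows "bsum (bsum r s) t \<cong>\<^sub>o bsum r (bsum s t)"
proof (rule order_isoI[where f = "case_sum (case_sum Inl (Inr \<circ> Inl)) (Inr \<circ> Inr)"])
  let ?f = "case_sum (case_sum Inl (Inr \<circ> Inl)) (Inr \<circ> Inr)"
  show "?f ` Field (bsum (bsum r s) t) = Field (bsum r (bsum s t))"
    unfolding Field_bsum Plus_def image_Un image_image by auto
  fix x y assume "(x, y) \<in> bsum (bsum r s) t" "x \<noteq> y"
  then show "(?f x, ?f y) \<in> bsum r (bsum s t) \<and> ?f x \<noteq> ?f y"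
    by (cases x rule: sum.exhaust; cases y rule: sum.exhaust) (auto simp: Field_bsum split: sum.splits)
qed (simp_all add: assms ctbl_order_bsum)

lemma ctbl_order_empty: "ctbl_order ({} :: 'a rel)"
  by (simp add: ctbl_order_def order_on_defs refl_on_def)

lemma bsum_empty:
  assumes "ctbl_order r"
  shows "bsum {} r \<cong>\<^sub>o r" "bsum r {} \<cong>\<^sub>o r"
proof -
  show "bsum {} r \<cong>\<^sub>o r"
  proof (rule order_isoI[where f = "case_sum undefined id"])
    fix x y assume "(x, y) \<in> bsum {} r" "x \<noteq> y"
    then show "(case_sum undefined id x, case_sum undefined id y) \<in> r \<and>
        case_sum undefined id x \<noteq> case_sum undefined id y"
      by (cases x; cases y) auto
  qed (auto simp: assms ctbl_order_bsum ctbl_order_empty Field_bsum Plus_def image_image)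
  show "bsum r {} \<cong>\<^sub>o r"
  proof (rule order_isoI[where f = "case_sum id undefined"])
    fix x y assume "(x, y) \<in> bsum r {}" "x \<noteq> y"
    then show "(case_sum id undefined x, case_sum id undefined y) \<in> r \<and>
        case_sum id undefined x \<noteq> case_sum id undefined y"
      by (cases x; cases y) auto
  qed (auto simp: assms ctbl_order_bsum ctbl_order_empty Field_bsum Plus_def image_image)
qed

lemma Field_Restr_ctbl_order: "ctbl_order r \<Longrightarrow> A \<subseteq> Field r \<Longrightarrow> Field (Restr r A) = A"
  by (rule Refl_Field_Restr2[OF ctbl_order_imp_Refl])

text \<open>Passes from an internal cut of an order to an external sum.\<close>

lemma Restr_Un_iso:
  assumes "ctbl_order r" "A \<subseteq> Field r" "B \<subseteq> Field r" "A \<inter> B = {}"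
    and AB: "\<And>a b. a \<in> A \<Longrightarrow> b \<in> B \<Longrightarrow> (a, b) \<in> r"
  shows "bsum (Restr r A) (Restr r B) \<cong>\<^sub>o Restr r (A \<union> B)"
proof (rule order_isoI[where f = "case_sum id id"])
  have F: "Field (Restr r A) = A" "Field (Restr r B) = B"
    by (intro Field_Restr_ctbl_order assms(1-3))+
  have "A \<union> B \<subseteq> Field r"
    using assms by blast
  then show "case_sum id id ` Field (bsum (Restr r A) (Restr r B)) = Field (Restr r (A \<union> B))"
    by (simp only: F Field_Restr_ctbl_order assms(1) Field_bsum Plus_def image_Un image_image) simp
  fix x y assume "(x, y) \<in> bsum (Restr r A) (Restr r B)" "x \<noteq> y"
  then show "(case_sum id id x, case_sum id id y) \<in> Restr r (A \<union> B) \<and> case_sum id id x \<noteq> case_sum id id y"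
    using F AB assms(4) by (cases x; cases y) auto
qed (intro ctbl_order_bsum ctbl_order_Restr assms(1))+

subsection \<open>Order types of countable linear orders\<close>

text \<open>Classes are formed among relations on \<open>nat\<close> so that they are sets of a
  fixed type. Isomorphism becomes equality, and sums of orders can be treated as algebra in a
  monoid.\<close>

typedef otype = "{C :: nat rel set. \<exists>r :: nat rel. Linear_order r \<and> C = {t. t \<cong>\<^sub>o r}}"
  using ctbl_order_imp_Linear_order[OF ctbl_order_empty, where 'a = nat] by blast

text \<open>Meaningful for countable linear orders only, since others have no copy in the carrier of
  \<open>otype\<close>.\<close>

definition ot :: "'a rel \<Rightarrow> otype" where
  "ot r = Abs_otype {t :: nat rel. t \<cong>\<^sub>o r}"

lemma ot_eqI: "r \<cong>\<^sub>o s \<Longrightarrow> ot r = ot s"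
  unfolding ot_def using order_iso_trans order_iso_sym by metis

text \<open>The two orders are replaced by copies on \<open>nat\<close>, whose classes lie in the
  carrier of the type, where \<open>Abs_otype\<close> is injective.\<close>

lemma ot_eqD:
  fixes r :: "'a rel" and s :: "'b rel"
  assumes "ot r = ot s" "ctbl_order r" "ctbl_order s"
  shows "r \<cong>\<^sub>o s"
proof -
  obtain r' :: "nat rel" where r: "Linear_order r'" "r' \<cong>\<^sub>o r"
    using ctbl_order_nat_copy[OF assms(2)] .
  obtain s' :: "nat rel" where s: "Linear_order s'" "s' \<cong>\<^sub>o s"
    using ctbl_order_nat_copy[OF assms(3)] .
  have "ot r' = ot s'"
    using assms(1) ot_eqI[OF r(2)] ot_eqI[OF s(2)] by simp
  then have "{t :: nat rel. t \<cong>\<^sub>o r'} = {t. t \<cong>\<^sub>o s'}"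
    unfolding ot_def using r(1) s(1) by (subst (asm) Abs_otype_inject) auto
  then have "r' \<cong>\<^sub>o s'"
    using order_iso_refl by blast
  then show ?thesis
    using r(2) s(2) order_iso_trans order_iso_sym by metis
qed

lemma ot_cases:
  obtains r :: "nat rel" where "ctbl_order r" "x = ot r"
proof -
  obtain r :: "nat rel" where "Linear_order r" "Rep_otype x = {t. t \<cong>\<^sub>o r}"
    using Rep_otype[of x] by blast
  then show thesis
    using that[of r] Rep_otype_inverse[of x] ctbl_order_nat unfolding ot_def by metis
qed

definition orep :: "otype \<Rightarrow> nat rel" where
  "orep x = (SOME r. ctbl_order r \<and> x = ot r)"

lemma ctbl_order_orep: "ctbl_order (orep x)" and ot_orep: "ot (orep x) = x"
proof -
  have "ctbl_order (orep x) \<and> x = ot (orep x)"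
    unfolding orep_def by (rule someI_ex) (use ot_cases in metis)
  then show "ctbl_order (orep x)" "ot (orep x) = x" by simp_all
qed

lemma orep_ot: "ctbl_order r \<Longrightarrow> orep (ot r) \<cong>\<^sub>o r"
  by (simp add: ot_eqD ctbl_order_orep ot_orep)

instantiation otype :: "{zero, one, plus}"
begin

definition "0 = ot ({} :: nat rel)"
definition "1 = ot ord_one"
definition "x + y = ot (bsum (orep x) (orep y))"

instance ..

end

lemma ot_bsum: "ctbl_order r \<Longrightarrow> ctbl_order s \<Longrightarrow> ot (bsum r s) = ot r + ot s"
  unfolding plus_otype_def
  by (intro ot_eqI order_iso_sym[OF bsum_iso] orep_ot ctbl_order_orep)

lemma ot_empty: "ot {} = 0"
proof -
  have "({} :: 'a rel) \<cong>\<^sub>o ({} :: nat rel)"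
    by (rule order_isoI[where f = undefined]) (auto simp: ctbl_order_empty)
  then show ?thesis
    unfolding zero_otype_def by (rule ot_eqI)
qed

instance otype :: monoid_add
proof
  fix a b c :: otype
  obtain r :: "nat rel" where r: "ctbl_order r" "a = ot r" using ot_cases .
  obtain s :: "nat rel" where s: "ctbl_order s" "b = ot s" using ot_cases .
  obtain t :: "nat rel" where t: "ctbl_order t" "c = ot t" using ot_cases .
  show "a + b + c = a + (b + c)"
    using ot_eqI[OF bsum_assoc[OF r(1) s(1) t(1)]] r s t by (simp add: ot_bsum ctbl_order_bsum)
  show "0 + a = a" "a + 0 = a"
    using bsum_empty[OF r(1), THEN ot_eqI] r by (simp_all add: ot_bsum ctbl_order_empty ot_empty)
qed

lemma ot_eq_0_iff: "ctbl_order r \<Longrightarrow> ot r = 0 \<longleftrightarrow> Field r = {}"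
proof
  assume "ctbl_order r" "ot r = 0"
  then have "r \<cong>\<^sub>o ({} :: nat rel)"
    by (simp add: ot_eqD ctbl_order_empty zero_otype_def)
  then show "Field r = {}"
    by (auto simp: order_iso_iff bij_betw_def)
next
  assume "Field r = {}"
  then have "r = {}" by (auto simp: Field_def)
  then show "ot r = 0" by (simp add: ot_empty)
qed

lemma ot_Restr_Un:
  assumes "ctbl_order r" "A \<subseteq> Field r" "B \<subseteq> Field r" "A \<inter> B = {}"
    "\<And>a b. a \<in> A \<Longrightarrow> b \<in> B \<Longrightarrow> (a, b) \<in> r"
  shows "ot (Restr r (A \<union> B)) = ot (Restr r A) + ot (Restr r B)"
  using ot_eqI[OF Restr_Un_iso[OF assms]]
    ot_bsum[OF ctbl_order_Restr[OF assms(1)] ctbl_order_Restr[OF assms(1)], of A B]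
  by simp

text \<open>An isomorphism from the external sum onto \<open>S\<close> carries the summands to a
  lower and an upper part. So a decomposition of the type shows up as a cut of any given
  representative.\<close>

lemma ot_plusE:
  fixes S :: "'a rel"
  assumes "ctbl_order S" "ot S = a + b"
  obtains U V where "U \<union> V = Field S" "U \<inter> V = {}" "\<forall>u\<in>U. \<forall>v\<in>V. (u, v) \<in> S"
    "a = ot (Restr S U)" "b = ot (Restr S V)"
proof -
  obtain r :: "nat rel" where r: "ctbl_order r" "a = ot r" using ot_cases .
  obtain s :: "nat rel" where s: "ctbl_order s" "b = ot s" using ot_cases .
  have rs: "ctbl_order (bsum r s)" using r s by (simp add: ctbl_order_bsum)
  have "bsum r s \<cong>\<^sub>o S"
    using assms r s rs by (intro ot_eqD) (simp_all add: ot_bsum)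
  then obtain f where f: "f ` Field (bsum r s) = Field S"
    "\<And>a b. (a, b) \<in> bsum r s \<Longrightarrow> a \<noteq> b \<Longrightarrow> (f a, f b) \<in> S \<and> f a \<noteq> f b"
    using order_isoE by metis
  let ?U = "(\<lambda>x. f (Inl x)) ` Field r" and ?V = "(\<lambda>x. f (Inr x)) ` Field s"
  have 1: "?U \<union> ?V = Field S"
    using f(1) unfolding Field_bsum Plus_def image_Un image_image .
  have 2: "(u, v) \<in> S \<and> u \<noteq> v" if "u \<in> ?U" "v \<in> ?V" for u v
    using that f(2) by auto
  have F: "Field (Restr S ?U) = ?U" "Field (Restr S ?V) = ?V"
    using 1 by (intro Field_Restr_ctbl_order assms(1); blast)+
  have U: "r \<cong>\<^sub>o Restr S ?U"
  proof (rule order_isoI[where f = "\<lambda>x. f (Inl x)"])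
    fix a b assume *: "(a, b) \<in> r" "a \<noteq> b"
    then show "(f (Inl a), f (Inl b)) \<in> Restr S ?U \<and> f (Inl a) \<noteq> f (Inl b)"
      using f(2)[of "Inl a" "Inl b"] FieldI1[OF *(1)] FieldI2[OF *(1)] by simp
  qed (use r(1) assms(1) ctbl_order_Restr F in auto)
  have V: "s \<cong>\<^sub>o Restr S ?V"
  proof (rule order_isoI[where f = "\<lambda>x. f (Inr x)"])
    fix a b assume *: "(a, b) \<in> s" "a \<noteq> b"
    then show "(f (Inr a), f (Inr b)) \<in> Restr S ?V \<and> f (Inr a) \<noteq> f (Inr b)"
      using f(2)[of "Inr a" "Inr b"] FieldI1[OF *(1)] FieldI2[OF *(1)] by simp
  qed (use s(1) assms(1) ctbl_order_Restr F in auto)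
  show thesis
    using 1 2 r(2) s(2) ot_eqI[OF U] ot_eqI[OF V] by (intro that[of ?U ?V]) blast+
qed

text \<open>Both decompositions are cuts of one order, and of the two lower parts one contains the
  other; the segment between them is \<open>x\<close>. Almost all later case distinctions come from
  this fact.\<close>

lemma otype_refine:
  fixes a b c d :: otype
  assumes "a + b = c + d"
  shows "(\<exists>x. c = a + x \<and> b = x + d) \<or> (\<exists>x. a = c + x \<and> d = x + b)"
proof -
  obtain S :: "nat rel" where S: "ctbl_order S" "a + b = ot S" using ot_cases .
  have anti: "antisym S" using S(1) by (auto simp: ctbl_order_def order_on_defs)
  obtain U V where UV: "U \<union> V = Field S" "U \<inter> V = {}" "\<forall>u\<in>U. \<forall>v\<in>V. (u, v) \<in> S"
    "a = ot (Restr S U)" "b = ot (Restr S V)"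
    by (rule ot_plusE[OF S(1) S(2)[symmetric]])
  obtain U' V' where UV': "U' \<union> V' = Field S" "U' \<inter> V' = {}" "\<forall>u\<in>U'. \<forall>v\<in>V'. (u, v) \<in> S"
    "c = ot (Restr S U')" "d = ot (Restr S V')"
    by (rule ot_plusE[OF S(1) S(2)[symmetric, unfolded assms]])
  \<comment> \<open>Stated for two arbitrary cuts with nested lower parts, since either inclusion
    between \<open>U\<close> and \<open>U'\<close> may occur.\<close>
  have *: "ot (Restr S U2) = ot (Restr S U1) + ot (Restr S (U2 - U1)) \<and>
      ot (Restr S V1) = ot (Restr S (U2 - U1)) + ot (Restr S V2)"
    if "U1 \<union> V1 = Field S" "U1 \<inter> V1 = {}" "\<forall>u\<in>U1. \<forall>v\<in>V1. (u, v) \<in> S"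
      "U2 \<union> V2 = Field S" "U2 \<inter> V2 = {}" "\<forall>u\<in>U2. \<forall>v\<in>V2. (u, v) \<in> S"
      "U1 \<subseteq> U2" for U1 V1 U2 V2
  proof -
    have eq: "U2 = U1 \<union> (U2 - U1)" "V1 = (U2 - U1) \<union> V2"
      using that by blast+
    have "ot (Restr S (U1 \<union> (U2 - U1))) = ot (Restr S U1) + ot (Restr S (U2 - U1))"
      by (rule ot_Restr_Un[OF S(1)]) (use that in blast)+
    moreover have "ot (Restr S ((U2 - U1) \<union> V2)) = ot (Restr S (U2 - U1)) + ot (Restr S V2)"
      by (rule ot_Restr_Un[OF S(1)]) (use that in blast)+
    ultimately show ?thesis
      using eq by metis
  qed
  show ?thesis
  proof (cases "U \<subseteq> U'")
    case True
    then show ?thesis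
      using *[of U V U' V'] UV UV' by blast
  next
    case False
    then obtain u where u: "u \<in> U" "u \<in> V'"
      using UV(1) UV'(1) by blast
    \<comment> \<open>The point \<open>u\<close> of \<open>U\<close> lies above all of
      \<open>U'\<close>, and \<open>U\<close> is closed downwards.\<close>
    have "U' \<subseteq> U"
    proof
      fix w assume w: "w \<in> U'"
      then have "(w, u) \<in> S" "w \<noteq> u" using UV' u by blast+
      then have "(u, w) \<notin> S" using anti by (auto dest: antisymD)
      then show "w \<in> U" using UV u w UV'(1) by blast
    qed
    then show ?thesis
      using *[of U' V' U V] UV UV' by blast
  qed
qed

lemma otype_plus_eq_0: "(a :: otype) + b = 0 \<longleftrightarrow> a = 0 \<and> b = 0"
proof -
  obtain r :: "nat rel" where r: "ctbl_order r" "a = ot r" using ot_cases .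
  obtain s :: "nat rel" where s: "ctbl_order s" "b = ot s" using ot_cases .
  have "a + b = 0 \<longleftrightarrow> Field (bsum r s) = {}"
    using r s ot_eq_0_iff[OF ctbl_order_bsum[OF r(1) s(1)]] by (simp add: ot_bsum)
  then show ?thesis
    using r s by (auto simp: Field_bsum ot_eq_0_iff)
qed

lemma ctbl_order_ord_one: "ctbl_order ord_one"
  using ctbl_order_nat[OF fp_nat_Linear_order[OF fp_nat.one]] .

lemma Field_ord_one: "Field ord_one = {0}"
  by (auto simp: ord_one_def Field_def)

lemma one_neq_zero_otype: "(1 :: otype) \<noteq> 0"
  unfolding one_otype_def by (simp add: ot_eq_0_iff ctbl_order_ord_one Field_ord_one)

lemma otype_plus_eq_1:
  assumes "(a :: otype) + b = 1"
  shows "a = 0 \<or> b = 0"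
proof -
  have "ot ord_one = a + b" using assms by (simp add: one_otype_def)
  then obtain U V where UV: "U \<union> V = Field ord_one" "U \<inter> V = {}"
    "\<forall>u\<in>U. \<forall>v\<in>V. (u, v) \<in> ord_one"
    "a = ot (Restr ord_one U)" "b = ot (Restr ord_one V)"
    by (rule ot_plusE[OF ctbl_order_ord_one])
  from UV(1,2) consider "U = {}" | "V = {}" unfolding Field_ord_one Un_singleton_iff by auto
  then show ?thesis
    by cases (simp_all add: UV(4,5) ot_empty)
qed

subsection \<open>Multiples by omega and its reverse\<close>

definition omega_mult :: "otype \<Rightarrow> otype" where
  "omega_mult x = ot (natLeq \<times>\<^sub>o orep x)"

lemma ot_omega_mult: "ctbl_order r \<Longrightarrow> ot (natLeq \<times>\<^sub>o r) = omega_mult (ot r)"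
  unfolding omega_mult_def
  by (intro ot_eqI ordprod_iso order_iso_sym[OF orep_ot] ctbl_order_imp_Refl
      ctbl_order_natLeq ctbl_order_orep)

definition rev_ot :: "otype \<Rightarrow> otype" where
  "rev_ot x = ot ((orep x)\<inverse>)"

lemma ot_converse: "ctbl_order r \<Longrightarrow> ot (r\<inverse>) = rev_ot (ot r)"
  unfolding rev_ot_def by (intro ot_eqI converse_iso order_iso_sym[OF orep_ot])

lemma rev_ot_rev_ot [simp]: "rev_ot (rev_ot x) = x"
proof (rule ot_cases[of x])
  fix r :: "nat rel" assume r: "ctbl_order r" "x = ot r"
  then show ?thesis
    using ot_converse[OF ctbl_order_converse[OF r(1)]] by (simp add: ot_converse)
qed

lemma rev_ot_plus: "rev_ot (a + b) = rev_ot b + rev_ot a"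
proof -
  obtain r :: "nat rel" where r: "ctbl_order r" "a = ot r" using ot_cases .
  obtain s :: "nat rel" where s: "ctbl_order s" "b = ot s" using ot_cases .
  let ?f = "case_sum Inr Inl"
  have "(bsum r s)\<inverse> \<cong>\<^sub>o bsum (s\<inverse>) (r\<inverse>)"
  proof (rule order_isoI[where f = ?f])
    show "?f ` Field ((bsum r s)\<inverse>) = Field (bsum (s\<inverse>) (r\<inverse>))"
      unfolding Field_converse Field_bsum Plus_def image_Un image_image by auto
    fix x y assume "(x, y) \<in> (bsum r s)\<inverse>" "x \<noteq> y"
    then show "(?f x, ?f y) \<in> bsum (s\<inverse>) (r\<inverse>) \<and> ?f x \<noteq> ?f y"
      by (cases x rule: sum.exhaust; cases y rule: sum.exhaust) auto
  qed (use r s ctbl_order_bsum ctbl_order_converse in blast)+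
  then have "ot ((bsum r s)\<inverse>) = ot (bsum (s\<inverse>) (r\<inverse>))"
    by (rule ot_eqI)
  then show ?thesis
    using r s by (simp add: ot_converse ctbl_order_bsum ot_bsum ctbl_order_converse)
qed

lemma rev_ot_0 [simp]: "rev_ot 0 = 0"
  using ot_converse[OF ctbl_order_empty] by (simp add: ot_empty)

lemma rev_ot_1 [simp]: "rev_ot 1 = 1"
proof -
  have "ord_one\<inverse> = ord_one" by (auto simp: ord_one_def)
  then show ?thesis
    using ot_converse[OF ctbl_order_ord_one] by (simp add: one_otype_def)
qed

text \<open>Reversal exchanges the two kinds of product, so whatever is proved for
  \<open>omega_mult\<close> transfers by conjugation with \<open>rev_ot\<close>.\<close>

lemma ot_omega_rev:
  assumes "ctbl_order r"
  shows "ot (natLeq\<inverse> \<times>\<^sub>o r) = rev_ot (omega_mult (rev_ot (ot r)))"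
proof -
  have "natLeq\<inverse> \<times>\<^sub>o r = (natLeq \<times>\<^sub>o r\<inverse>)\<inverse>"
    by (auto simp: mem_ordprod)
  then show ?thesis
    using assms by (simp add: ot_converse[symmetric] ot_omega_mult[symmetric]
      ctbl_order_ordprod ctbl_order_converse ctbl_order_natLeq)
qed

lemma Field_natLeq_prod: "ctbl_order r \<Longrightarrow> Field (natLeq \<times>\<^sub>o r) = UNIV \<times> Field r"
  using Field_ordprod[of natLeq r] ctbl_order_imp_Refl[OF ctbl_order_natLeq] ctbl_order_imp_Refl[of r]
  unfolding Field_natLeq by blast

text \<open>Rebracketing: \<open>(a + b) + (a + b) + ...\<close> is
  \<open>a + (b + a) + (b + a) + ...\<close>. The map \<open>?f\<close> sends the leading
  \<open>a\<close> to block 0 and the \<open>a\<close> of block \<open>i\<close> on the left to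
  block \<open>Suc i\<close>.\<close>

lemma omega_mult_plus: "omega_mult (a + b) = a + omega_mult (b + a)"
proof -
  obtain r :: "nat rel" where r: "ctbl_order r" "a = ot r" using ot_cases .
  obtain s :: "nat rel" where s: "ctbl_order s" "b = ot s" using ot_cases .
  let ?f = "case_sum (\<lambda>x. (0, Inl x)) (\<lambda>(i, z). case_sum (\<lambda>y. (i, Inr y)) (\<lambda>x. (Suc i, Inl x)) z)"
  have clos: "ctbl_order (bsum r s)" "ctbl_order (bsum s r)"
    "ctbl_order (natLeq \<times>\<^sub>o bsum r s)" "ctbl_order (natLeq \<times>\<^sub>o bsum s r)"
    "ctbl_order (bsum r (natLeq \<times>\<^sub>o bsum s r))"
    using r s by (simp_all add: ctbl_order_bsum ctbl_order_ordprod ctbl_order_natLeq)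
  have "bsum r (natLeq \<times>\<^sub>o bsum s r) \<cong>\<^sub>o natLeq \<times>\<^sub>o bsum r s"
  proof (rule order_isoI[where f = ?f])
    show "?f ` Field (bsum r (natLeq \<times>\<^sub>o bsum s r)) = Field (natLeq \<times>\<^sub>o bsum r s)"
    proof (intro equalityI subsetI)
      fix p assume "p \<in> Field (natLeq \<times>\<^sub>o bsum r s)"
      then obtain i z where p: "p = (i, z)" "z \<in> Field r <+> Field s"
        using clos by (auto simp: Field_natLeq_prod Field_bsum)
      have *: "?f q \<in> ?f ` Field (bsum r (natLeq \<times>\<^sub>o bsum s r))"
        if "q \<in> Field r <+> (UNIV \<times> (Field s <+> Field r))" for q
        using that clos by (simp add: Field_natLeq_prod Field_bsum)
      show "p \<in> ?f ` Field (bsum r (natLeq \<times>\<^sub>o bsum s r))"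
      proof (cases z)
        case (Inl x)
        then show ?thesis
          \<comment> \<open>In block 0 the preimage is the leading summand; in a later block
            \<open>i\<close> it is the second half of block \<open>i - 1\<close>.\<close>
          using *[of "Inl x"] *[of "Inr (i - 1, Inr x)"] p by (cases i) auto
      next
        case (Inr y)
        then show ?thesis
          using *[of "Inr (i, Inl y)"] p by auto
      qed
    qed (use clos in \<open>auto simp: Field_natLeq_prod Field_bsum\<close>)
    fix p q assume "(p, q) \<in> bsum r (natLeq \<times>\<^sub>o bsum s r)" "p \<noteq> q"
    then show "(?f p, ?f q) \<in> natLeq \<times>\<^sub>o bsum r s \<and> ?f p \<noteq> ?f q"
      using clos
      by (cases p; cases q)
         (auto simp: mem_ordprod Field_natLeq_prod Field_bsum FieldI1 FieldI2 split: sum.splits)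
  qed (use clos in blast)+
  then have "ot (bsum r (natLeq \<times>\<^sub>o bsum s r)) = ot (natLeq \<times>\<^sub>o bsum r s)"
    by (rule ot_eqI)
  then show ?thesis
    using r s clos by (simp add: ot_bsum ot_omega_mult)
qed

lemma mem_natsum:
  "((i, a), (j, b)) \<in> natsum I L \<longleftrightarrow> i \<in> I \<and> j \<in> I \<and> a \<in> Field (L i) \<and> b \<in> Field (L j) \<and>
     (i < j \<or> i = j \<and> (a, b) \<in> L i)"
  unfolding natsum_def ordsum_def by (auto simp: Field_Restr_natLeq)

lemma Field_natsum:
  assumes "\<And>i. i \<in> I \<Longrightarrow> ctbl_order (L i)"
  shows "Field (natsum I L) = Sigma I (\<lambda>i. Field (L i))"
proof -
  have "Refl (Restr natLeq I)"
    by (rule ctbl_order_imp_Refl[OF ctbl_order_nat[OF Linear_order_Restr_natLeq]])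
  then show ?thesis
    using Field_ordsum[of "Restr natLeq I" L] assms
    unfolding natsum_def Field_Restr_natLeq by (metis ctbl_order_imp_Refl)
qed

lemma ot_natsum_Un:
  assumes "\<And>i. i \<in> I \<union> J \<Longrightarrow> ctbl_order (L i)" and less: "\<And>i j. i \<in> I \<Longrightarrow> j \<in> J \<Longrightarrow> i < j"
  shows "ot (natsum (I \<union> J) L) = ot (natsum I L) + ot (natsum J L)"
proof -
  let ?f = "case_sum id id"
  have clos: "ctbl_order (natsum I L)" "ctbl_order (natsum J L)" "ctbl_order (natsum (I \<union> J) L)"
    using assms(1) by (intro ctbl_order_natsum; blast)+
  have F: "Field (natsum K L) = Sigma K (\<lambda>i. Field (L i))" if "K \<subseteq> I \<union> J" for K
    using assms(1) that by (intro Field_natsum) blast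
  have "bsum (natsum I L) (natsum J L) \<cong>\<^sub>o natsum (I \<union> J) L"
  proof (rule order_isoI[where f = ?f])
    show "?f ` Field (bsum (natsum I L) (natsum J L)) = Field (natsum (I \<union> J) L)"
      unfolding Field_bsum Plus_def image_Un image_image by (auto simp: F)
    fix x y assume "(x, y) \<in> bsum (natsum I L) (natsum J L)" "x \<noteq> y"
    then show "(?f x, ?f y) \<in> natsum (I \<union> J) L \<and> ?f x \<noteq> ?f y"
      using less by (cases x; cases y) (auto simp: mem_natsum F)
  qed (intro clos ctbl_order_bsum)+
  then show ?thesis
    using ot_eqI ot_bsum[OF clos(1,2)] by metis
qed

lemma ot_natsum_singleton:
  assumes "ctbl_order (L i)"
  shows "ot (natsum {i} L) = ot (L i)"
proof -
  have "ctbl_order (natsum {i} L)" "Field (natsum {i} L) = {i} \<times> Field (L i)"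
    using ctbl_order_natsum[of "{i}" L] Field_natsum[of "{i}" L] assms by auto
  then have "natsum {i} L \<cong>\<^sub>o L i"
    using assms by (intro order_isoI[where f = snd]) (auto simp: mem_natsum)
  then show ?thesis by (rule ot_eqI)
qed

lemma ot_natsum_empty: "ot (natsum {} L) = 0"
proof -
  have "natsum {} L = {}" by (auto simp: mem_natsum)
  then show ?thesis by (simp add: ot_empty)
qed

text \<open>Turns the sums of the definitions into \<open>sum_list\<close> in the monoid of types,
  where the combinatorial part of the proof takes place.\<close>

lemma ot_natsum:
  assumes "\<And>i. m \<le> i \<Longrightarrow> i < n \<Longrightarrow> ctbl_order (L i)"
  shows "ot (natsum {m..<n} L) = sum_list (map (\<lambda>i. ot (L i)) [m..<n])"
  using assms
proof (induction n)
  case (Suc n)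
  show ?case
  proof (cases "m \<le> n")
    case True
    then have "{m..<Suc n} = {m..<n} \<union> {n}" by auto
    then have "ot (natsum {m..<Suc n} L) = ot (natsum ({m..<n} \<union> {n}) L)" by simp
    also have "\<dots> = ot (natsum {m..<n} L) + ot (natsum {n} L)"
      by (rule ot_natsum_Un) (use Suc.prems True in auto)
    finally show ?thesis
      using Suc True by (simp add: ot_natsum_singleton)
  qed (simp add: ot_natsum_empty)
qed (simp add: ot_natsum_empty)

text \<open>Grouping the copies into blocks of length \<open>m\<close> changes nothing: position
  \<open>j\<close> of block \<open>i\<close> is copy \<open>i * m + j\<close>, and
  \<open>div\<close> and \<open>mod\<close> give the inverse.\<close>

lemma omega_mult_sum_copies:
  fixes r :: "nat rel"
  assumes "ctbl_order r" "m > 0"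
  shows "omega_mult (ot (natsum {..<m} (\<lambda>_. r))) = omega_mult (ot r)"
proof -
  let ?f = "\<lambda>(i, j, x). (i * m + j, x)"
  have clos: "ctbl_order (natsum {..<m} (\<lambda>_. r))" "ctbl_order (natLeq \<times>\<^sub>o natsum {..<m} (\<lambda>_. r))"
    using assms(1) by (simp_all add: ctbl_order_natsum ctbl_order_ordprod ctbl_order_natLeq)
  have "natLeq \<times>\<^sub>o natsum {..<m} (\<lambda>_. r) \<cong>\<^sub>o natLeq \<times>\<^sub>o r"
  proof (rule order_isoI[where f = ?f])
    show "?f ` Field (natLeq \<times>\<^sub>o natsum {..<m} (\<lambda>_. r)) = Field (natLeq \<times>\<^sub>o r)"
    proof (intro equalityI subsetI)
      fix p assume "p \<in> Field (natLeq \<times>\<^sub>o r)"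
      then obtain k x where p: "p = (k, x)" "x \<in> Field r"
        using assms by (auto simp: Field_natLeq_prod)
      then have "p = ?f (k div m, k mod m, x)" by simp
      moreover have "(k div m, k mod m, x) \<in> Field (natLeq \<times>\<^sub>o natsum {..<m} (\<lambda>_. r))"
        using assms p clos by (simp add: Field_natLeq_prod Field_natsum)
      ultimately show "p \<in> ?f ` Field (natLeq \<times>\<^sub>o natsum {..<m} (\<lambda>_. r))" by blast
    qed (use assms clos in \<open>auto simp: Field_natLeq_prod Field_natsum\<close>)
    fix p q assume *: "(p, q) \<in> natLeq \<times>\<^sub>o natsum {..<m} (\<lambda>_. r)" "p \<noteq> q"
    obtain i j x i' j' x' where pq: "p = (i, j, x)" "q = (i', j', x')" by (metis surj_pair)
    have j: "j < m" "j' < m" "x \<in> Field r" "x' \<in> Field r"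
      and cases: "i < i' \<or> i = i' \<and> (j < j' \<or> j = j' \<and> (x, x') \<in> r)"
      using * assms(1) unfolding pq by (auto simp: mem_ordprod mem_natsum Field_natsum)
    have "i * m + j < i' * m + j'" if "i < i'"
    proof -
      have "i * m + j < Suc i * m" using j by simp
      also have "\<dots> \<le> i' * m" using that by (intro mult_le_mono1) simp
      finally show ?thesis by simp
    qed
    then show "(?f p, ?f q) \<in> natLeq \<times>\<^sub>o r \<and> ?f p \<noteq> ?f q"
      using cases j *(2) unfolding pq by (auto simp: mem_ordprod)
  qed (use assms clos ctbl_order_ordprod ctbl_order_natLeq in blast)+
  then have "ot (natLeq \<times>\<^sub>o natsum {..<m} (\<lambda>_. r)) = ot (natLeq \<times>\<^sub>o r)"
    by (rule ot_eqI)
  then show ?thesis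
    using assms clos by (simp add: ot_omega_mult)
qed

text \<open>A point of the upper part lies in some copy \<open>k\<close>, so the lower part stays
  within finitely many copies. The type \<open>q\<close> is what remains of these copies above the
  cut, and after them comes a shifted version of the whole.\<close>

lemma omega_mult_cut_copies:
  fixes r :: "nat rel"
  assumes "ctbl_order r" "omega_mult (ot r) = a + b" "b \<noteq> 0"
  obtains m q where "m > 0" "a + q = ot (natsum {..<m} (\<lambda>_. r))" "b = q + omega_mult (ot r)"
proof -
  let ?S = "natLeq \<times>\<^sub>o r"
  have S: "ctbl_order ?S" "ot ?S = a + b" and FS: "Field ?S = UNIV \<times> Field r"
    using assms by (simp_all add: ctbl_order_ordprod ctbl_order_natLeq ot_omega_mult Field_natLeq_prod)
  obtain U V where UV: "U \<union> V = Field ?S" "U \<inter> V = {}" "\<forall>u\<in>U. \<forall>v\<in>V. (u, v) \<in> ?S"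
    "a = ot (Restr ?S U)" "b = ot (Restr ?S V)"
    by (rule ot_plusE[OF S])
  have "V \<noteq> {}"
    using UV(5) assms(3) by (auto simp: ot_empty)
  then obtain k y where ky: "(k, y) \<in> V" by auto
  \<comment> \<open>The successor includes copy \<open>k\<close> itself, in which \<open>U\<close>
    may still have points below \<open>y\<close>.\<close>
  define m where "m = Suc k"
  let ?W = "{..<m} \<times> Field r" and ?Z = "{m..} \<times> Field r"
  have UW: "U \<subseteq> ?W"
  proof
    fix p assume p: "p \<in> U"
    obtain i x where "p = (i, x)" by force
    moreover have "(p, k, y) \<in> ?S" using UV(3) ky p by blast
    ultimately show "p \<in> ?W" by (auto simp: mem_ordprod m_def)
  qed
  have WF: "?W \<subseteq> Field ?S" "?Z \<subseteq> Field ?S" by (auto simp: FS)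
  define q where "q = ot (Restr ?S (?W - U))"
  have W: "Restr ?S ?W = natsum {..<m} (\<lambda>_. r)"
    by (auto simp: mem_natsum mem_ordprod FieldI1 FieldI2)
  have "ot (Restr ?S (U \<union> (?W - U))) = ot (Restr ?S U) + ot (Restr ?S (?W - U))"
    by (rule ot_Restr_Un[OF S(1)]) (use UV WF in blast)+
  moreover have "U \<union> (?W - U) = ?W" using UW by blast
  ultimately have 1: "a + q = ot (natsum {..<m} (\<lambda>_. r))"
    using W UV(4) by (simp add: q_def)
  have "ot (Restr ?S ((?W - U) \<union> ?Z)) = ot (Restr ?S (?W - U)) + ot (Restr ?S ?Z)"
    by (rule ot_Restr_Un[OF S(1)]) (use WF in \<open>auto simp: mem_ordprod\<close>)
  moreover have "V = (?W - U) \<union> ?Z"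
  proof -
    have "?W \<union> ?Z = Field ?S" "?W \<inter> ?Z = {}" by (auto simp: FS)
    then show ?thesis using UV(1,2) UW by blast
  qed
  ultimately have 2: "b = q + ot (Restr ?S ?Z)"
    using UV(5) by (simp add: q_def)
  \<comment> \<open>Deleting the first \<open>m\<close> copies leaves the whole product, shifted by
    \<open>m\<close>.\<close>
  have "?S \<cong>\<^sub>o Restr ?S ?Z"
  proof (rule order_isoI[where f = "\<lambda>(i, x). (m + i, x)"])
    show "(\<lambda>(i, x). (m + i, x)) ` Field ?S = Field (Restr ?S ?Z)"
      unfolding Field_Restr_ctbl_order[OF S(1) WF(2)] unfolding FS
      by (auto simp: image_iff le_iff_add)
  qed (use S ctbl_order_Restr in \<open>auto simp: mem_ordprod\<close>)
  then have "ot (Restr ?S ?Z) = omega_mult (ot r)"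
    using ot_eqI assms(1) by (metis ot_omega_mult)
  then show thesis
    using that[of m q] 1 2 by (simp add: m_def)
qed

subsection \<open>Order types of finitely presented orders\<close>

lemma omega_mult_0 [simp]: "omega_mult 0 = 0"
proof -
  let ?r = "natLeq \<times>\<^sub>o ({} :: nat rel)"
  have "omega_mult 0 = ot ?r"
    by (simp add: ot_omega_mult ctbl_order_empty ot_empty)
  moreover have "?r = {}"
    by (auto simp: mem_ordprod)
  ultimately show ?thesis by (simp add: ot_empty)
qed

lemma omega_mult_unfold: "omega_mult a = a + omega_mult a"
  using omega_mult_plus[of a 0] by simp

lemma omega_mult_eq_0_iff [simp]: "omega_mult a = 0 \<longleftrightarrow> a = 0"
  by (metis omega_mult_0 omega_mult_unfold otype_plus_eq_0)

definition omega_rev_mult :: "otype \<Rightarrow> otype" where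
  "omega_rev_mult x = rev_ot (omega_mult (rev_ot x))"

text \<open>The period \<open>n\<close> is replaced by a multiple \<open>a + q\<close> that contains
  the cut. Rotating this period by \<open>omega_mult_plus\<close> shows that the upper part is again
  a multiple of \<omega>.\<close>

lemma omega_mult_cut:
  assumes "omega_mult n = a + b" "b \<noteq> 0"
  obtains m q where "a + q = sum_list (replicate m n)" "omega_mult n = omega_mult (a + q)"
    "b = omega_mult (q + a)"
proof -
  obtain r :: "nat rel" where r: "ctbl_order r" "n = ot r" using ot_cases .
  obtain m q where m: "m > 0" "a + q = ot (natsum {..<m} (\<lambda>_. r))" "b = q + omega_mult (ot r)"
    using omega_mult_cut_copies[OF r(1)] assms r(2) by metis
  have "omega_mult n = omega_mult (a + q)"
    using omega_mult_sum_copies[OF r(1) m(1)] m(2) r(2) by simp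
  moreover have "ot (natsum {..<m} (\<lambda>_. r)) = sum_list (replicate m n)"
    using ot_natsum[of 0 m "\<lambda>_. r"] r by (simp add: atLeast0LessThan map_replicate_const)
  ultimately show thesis
    using that m r(2) by (simp add: omega_mult_plus[of q a])
qed

text \<open>Counterpart of \<open>fp_nat\<close> for types: isomorphism has become equality, and
  finite sums are iterated binary ones.\<close>

inductive_set fp_types :: "otype set" where
  zero: "0 \<in> fp_types"
| one: "1 \<in> fp_types"
| plus: "a \<in> fp_types \<Longrightarrow> b \<in> fp_types \<Longrightarrow> a + b \<in> fp_types"
| omega_mult: "a \<in> fp_types \<Longrightarrow> omega_mult a \<in> fp_types"
| omega_rev_mult: "a \<in> fp_types \<Longrightarrow> omega_rev_mult a \<in> fp_types"

lemma fp_types_rev: "a \<in> fp_types \<Longrightarrow> rev_ot a \<in> fp_types"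
proof (induction rule: fp_types.induct)
  case (omega_mult a)
  then show ?case using fp_types.omega_rev_mult[OF omega_mult.IH] by (simp add: omega_rev_mult_def)
next
  case (omega_rev_mult a)
  then show ?case using fp_types.omega_mult[OF omega_rev_mult.IH] by (simp add: omega_rev_mult_def)
qed (simp_all add: fp_types.intros rev_ot_plus)

lemma sum_list_fp_types: "set xs \<subseteq> fp_types \<Longrightarrow> sum_list xs \<in> fp_types"
  by (induction xs) (auto intro: fp_types.intros)

lemma ctbl_order_fp_nat: "fp_nat r \<Longrightarrow> ctbl_order r"
  by (rule ctbl_order_nat[OF fp_nat_Linear_order])

lemma ot_enc: "ot (enc r) = ot r"
  by (rule ot_eqI[OF order_iso_sym[OF order_iso_enc]])

lemma fp_nat_fp_types: "fp_nat r \<Longrightarrow> ot r \<in> fp_types"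
proof (induction rule: fp_nat.induct)
  case zero
  then show ?case by (simp add: ot_empty fp_types.zero)
next
  case one
  then show ?case using fp_types.one by (simp add: one_otype_def)
next
  case (sum n L)
  have "ot (natsum {0..<n} L) = sum_list (map (\<lambda>i. ot (L i)) [0..<n])"
    by (rule ot_natsum) (use sum ctbl_order_fp_nat in blast)
  then show ?case
    using sum by (auto simp: ot_enc atLeast0LessThan intro!: sum_list_fp_types)
next
  case (omega r)
  then show ?case by (simp add: ot_enc ot_omega_mult ctbl_order_fp_nat fp_types.omega_mult)
next
  case (omega_rev r)
  then show ?case using fp_types.omega_rev_mult
    by (simp add: ot_enc ot_omega_rev ctbl_order_fp_nat omega_rev_mult_def)
next
  case (iso r s)
  then show ?case using ot_eqI by metis
qed

section \<open>Closure of the finitely presented types under summands\<close>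

text \<open>With \<open>b = 0\<close> this contains membership of \<open>x\<close> in
  \<open>fp_types\<close>; it is the strengthening of membership that is carried through the
  induction.\<close>

definition closed_summands :: "otype \<Rightarrow> bool" where
  "closed_summands x \<longleftrightarrow> (\<forall>a b. x = a + b \<longrightarrow> a \<in> fp_types \<and> b \<in> fp_types)"

text \<open>By refinement, a cut of a sum is a cut of one of the two summands.\<close>

lemma closed_summands_plus:
  assumes "closed_summands x" "closed_summands y"
  shows "closed_summands (x + y)"
  unfolding closed_summands_def
proof (intro allI impI)
  fix a b assume "x + y = a + b"
  then consider z where "a = x + z" "y = z + b" | z where "x = a + z" "b = z + y"
    using otype_refine by blast
  moreover have "x \<in> fp_types" "y \<in> fp_types"
    using assms unfolding closed_summands_def by (metis add.right_neutral)+
  ultimately show "a \<in> fp_types \<and> b \<in> fp_types"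
    by cases (use assms fp_types.plus in \<open>auto simp: closed_summands_def\<close>)
qed

lemma closed_summands_rev: "closed_summands x \<Longrightarrow> closed_summands (rev_ot x)"
  unfolding closed_summands_def by (metis fp_types_rev rev_ot_plus rev_ot_rev_ot)

lemma closed_summands_replicate:
  "closed_summands x \<Longrightarrow> closed_summands (sum_list (replicate m x))"
proof (induction m)
  case 0
  then show ?case
    using otype_plus_eq_0 fp_types.zero unfolding closed_summands_def
    by (metis replicate_0 sum_list.Nil)
qed (simp add: closed_summands_plus)

text \<open>A proper cut falls within finitely many copies of \<open>x\<close>, so both
  \<open>a\<close> and the remainder \<open>q\<close> are summands of a finite multiple of
  \<open>x\<close>.\<close>

lemma closed_summands_omega_mult:
  assumes "closed_summands x"
  shows "closed_summands (omega_mult x)"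
  unfolding closed_summands_def
proof (intro allI impI)
  fix a b assume ab: "omega_mult x = a + b"
  show "a \<in> fp_types \<and> b \<in> fp_types"
  proof (cases "b = 0")
    case True
    have "x \<in> fp_types"
      using assms unfolding closed_summands_def by (metis add.right_neutral)
    then show ?thesis
      using True ab fp_types.omega_mult fp_types.zero by (metis add.right_neutral)
  next
    case False
    obtain m q where "a + q = sum_list (replicate m x)" "b = omega_mult (q + a)"
      using omega_mult_cut[OF ab False] by metis
    then show ?thesis
      using closed_summands_replicate[OF assms, of m] fp_types.intros
      unfolding closed_summands_def by metis
  qed
qed

lemma fp_types_closed_summands: "x \<in> fp_types \<Longrightarrow> closed_summands x"
proof (induction rule: fp_types.induct)
  case zero
  then show ?case
    using otype_plus_eq_0 fp_types.zero unfolding closed_summands_def by metis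
next
  case one
  then show ?case
    using otype_plus_eq_1 fp_types.zero fp_types.one unfolding closed_summands_def
    by (metis add.left_neutral add.right_neutral)
qed (simp_all add: closed_summands_plus closed_summands_omega_mult closed_summands_rev omega_rev_mult_def)

lemma fp_types_plusD: "a + b \<in> fp_types \<Longrightarrow> a \<in> fp_types" "a + b \<in> fp_types \<Longrightarrow> b \<in> fp_types"
  using fp_types_closed_summands unfolding closed_summands_def by blast+

text \<open>A replacement for scatteredness: a segment containing two disjoint copies of itself
  would generate a copy of the rationals.\<close>

definition no_doubling :: "otype \<Rightarrow> bool" where
  "no_doubling x \<longleftrightarrow> (\<forall>s n t u v. x = s + n + t \<longrightarrow> n = u + n + n + v \<longrightarrow> n = 0)"

text \<open>The critical case is that \<open>n\<close> straddles the border between \<open>x\<close>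
  and \<open>y\<close>. The border lies on one side of the point where the two inner copies of
  \<open>n\<close> meet, so one of these copies lies entirely in \<open>x\<close> or entirely in
  \<open>y\<close>.\<close>

lemma no_doubling_plus:
  assumes "no_doubling x" "no_doubling y"
  shows "no_doubling (x + y)"
  unfolding no_doubling_def
proof (intro allI impI)
  fix s n t u v assume eq: "x + y = s + n + t" and n: "n = u + n + n + v"
  have X: "n = 0" if "x = s' + n + t'" for s' t'
    using assms(1) that n unfolding no_doubling_def by blast
  have Y: "n = 0" if "y = s' + n + t'" for s' t'
    using assms(2) that n unfolding no_doubling_def by blast
  have "x + y = s + (n + t)" using eq by (simp add: add.assoc)
  then consider z where "s = x + z" "y = z + (n + t)" | z where "x = s + z" "n + t = z + y"
    using otype_refine by metis
  then show "n = 0"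
  proof cases
    case 1
    then show ?thesis using Y[of z t] by (simp add: add.assoc)
  next
    case (2 z)
    then consider w where "z = n + w" | w where "n = z + w" "y = w + t"
      using otype_refine[of n t z y] by blast
    then show ?thesis
    proof cases
      case 1
      then show ?thesis using X[of s w] 2 by (simp add: add.assoc)
    next
      case (2 w)
      then have "z + w = (u + n) + (n + v)" using n by (metis add.assoc)
      then consider c where "z = u + n + c" | c where "w = c + (n + v)"
        using otype_refine by metis
      then show ?thesis
      proof cases
        case 1
        have "x = (s + u) + n + c"
          unfolding \<open>x = s + z\<close> 1 by (simp only: add.assoc)
        then show ?thesis by (rule X)
      next
        case c: 2
        have "y = c + n + (v + t)"
          unfolding 2(2) c by (simp only: add.assoc)
        then show ?thesis by (rule Y)
      qed
    qed
  qed
qed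

lemma no_doubling_rev: "no_doubling x \<Longrightarrow> no_doubling (rev_ot x)"
proof -
  assume x: "no_doubling x"
  show "no_doubling (rev_ot x)"
    unfolding no_doubling_def
  proof (intro allI impI)
    fix s n t u v assume "rev_ot x = s + n + t" "n = u + n + n + v"
    then have "x = rev_ot t + rev_ot n + rev_ot s"
      and "rev_ot n = rev_ot v + rev_ot n + rev_ot n + rev_ot u"
      by (metis rev_ot_rev_ot rev_ot_plus add.assoc)+
    then have "rev_ot n = 0" using x unfolding no_doubling_def by blast
    then show "n = 0" by (metis rev_ot_0 rev_ot_rev_ot)
  qed
qed

lemma no_doubling_0: "no_doubling 0"
  unfolding no_doubling_def by (metis otype_plus_eq_0)

lemma no_doubling_replicate:
  "no_doubling x \<Longrightarrow> no_doubling (sum_list (replicate m x))"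
  by (induction m) (simp_all add: no_doubling_0 no_doubling_plus)

text \<open>A cut between the two inner copies of \<open>n\<close> leaves a nonempty upper part. The
  first inner copy therefore lies in a finite multiple of \<open>x\<close>, for which the claim is
  known.\<close>

lemma no_doubling_omega_mult:
  assumes "no_doubling x"
  shows "no_doubling (omega_mult x)"
  unfolding no_doubling_def
proof (intro allI impI)
  fix s n t u v assume eq: "omega_mult x = s + n + t" and n: "n = u + n + n + v"
  show "n = 0"
  proof (rule ccontr)
    assume "n \<noteq> 0"
    have "omega_mult x = (s + u + n) + (n + v + t)"
      using eq n by (metis add.assoc)
    moreover have "n + v + t \<noteq> 0"
      using \<open>n \<noteq> 0\<close> by (simp add: otype_plus_eq_0)
    ultimately obtain m q where "s + u + n + q = sum_list (replicate m x)"
      using omega_mult_cut by metis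
    then show False
      using no_doubling_replicate[OF assms, of m] n \<open>n \<noteq> 0\<close> unfolding no_doubling_def by metis
  qed
qed

lemma fp_types_no_doubling: "x \<in> fp_types \<Longrightarrow> no_doubling x"
proof (induction rule: fp_types.induct)
  case one
  show ?case unfolding no_doubling_def
  proof (intro allI impI)
    fix s n t u v :: otype assume 1: "1 = s + n + t" and n: "n = u + n + n + v"
    show "n = 0"
    proof (rule ccontr)
      assume "n \<noteq> 0"
      have "(s + u + n) + (n + v + t) = 1" using 1 n by (metis add.assoc)
      then show False
        using \<open>n \<noteq> 0\<close> otype_plus_eq_1 otype_plus_eq_0 by metis
    qed
  qed
qed (simp_all add: no_doubling_0 no_doubling_plus no_doubling_omega_mult no_doubling_rev omega_rev_mult_def)

subsection \<open>Indecomposable types\<close>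

text \<open>The restriction to \<open>fp_types\<close> makes \<open>no_doubling\<close> available
  for the period and lets the product be realized by a tree.\<close>

definition up :: "otype \<Rightarrow> bool" where
  "up x \<longleftrightarrow> (\<exists>n\<in>fp_types. n \<noteq> 0 \<and> x = omega_mult n)"

text \<open>Defined by reversal so that facts about \<open>up\<close> transfer directly.\<close>

definition down :: "otype \<Rightarrow> bool" where
  "down x \<longleftrightarrow> up (rev_ot x)"

definition atom :: "otype \<Rightarrow> bool" where
  "atom x \<longleftrightarrow> x = 1 \<or> up x \<or> down x"

lemma down_iff: "down x \<longleftrightarrow> (\<exists>n\<in>fp_types. n \<noteq> 0 \<and> x = omega_rev_mult n)"
proof
  assume "down x"
  then obtain n where n: "n \<in> fp_types" "n \<noteq> 0" "rev_ot x = omega_mult n"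
    unfolding down_def up_def by blast
  then have "x = omega_rev_mult (rev_ot n)" "rev_ot n \<noteq> 0"
    unfolding omega_rev_mult_def by (metis rev_ot_rev_ot rev_ot_0)+
  then show "\<exists>n\<in>fp_types. n \<noteq> 0 \<and> x = omega_rev_mult n"
    using fp_types_rev[OF n(1)] by blast
next
  assume "\<exists>n\<in>fp_types. n \<noteq> 0 \<and> x = omega_rev_mult n"
  then obtain n where n: "n \<in> fp_types" "n \<noteq> 0" "x = omega_rev_mult n" by blast
  then have "rev_ot x = omega_mult (rev_ot n)" "rev_ot n \<noteq> 0"
    unfolding omega_rev_mult_def by (metis rev_ot_rev_ot rev_ot_0)+
  then show "down x"
    using fp_types_rev[OF n(1)] unfolding down_def up_def by blast
qed

text \<open>The cut lemma for multiples of \<omega>, with periods kept in \<open>fp_types\<close>.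
  The whole and its final segment get the periods \<open>a + q\<close> and \<open>q + a\<close>,
  which are rotations of each other.\<close>

lemma up_suffix:
  assumes "up (a + b)" "b \<noteq> 0"
  obtains q where "a + q \<in> fp_types" "a + b = omega_mult (a + q)" "b = omega_mult (q + a)" "up b"
proof -
  obtain n where n: "n \<in> fp_types" "omega_mult n = a + b"
    using assms(1) unfolding up_def by metis
  obtain m q where q: "a + q = sum_list (replicate m n)" "omega_mult n = omega_mult (a + q)"
    "b = omega_mult (q + a)"
    using omega_mult_cut[OF n(2) assms(2)] .
  have "sum_list (replicate m n) \<in> fp_types"
    using n(1) by (intro sum_list_fp_types) auto
  then have fp: "a + q \<in> fp_types" using q(1) by simp
  then have "q + a \<in> fp_types" using fp_types_plusD fp_types.plus by blast
  then have "up b"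
    using q(3) assms(2) unfolding up_def by (metis omega_mult_0)
  then show thesis using that fp q n(2) by metis
qed

lemma up_neq_0: "up x \<Longrightarrow> x \<noteq> 0"
  unfolding up_def by auto

lemma atom_neq_0: "atom x \<Longrightarrow> x \<noteq> 0"
  unfolding atom_def down_def using up_neq_0 one_neq_zero_otype by fastforce

text \<open>Reversal turns the first copy of \<open>n\<close> in \<open>x\<close> into a final
  segment \<open>?m\<close> of the \<omega>-atom \<open>rev_ot x\<close>. So \<open>?m\<close> is
  itself a multiple of \<omega>, with a period that ends in \<open>rev_ot (omega_mult n)\<close> and
  hence in \<open>?m\<close>. Thus \<open>?m\<close> contains two successive copies of itself,
  against \<open>no_doubling\<close>.\<close>

lemma not_up_down:
  assumes "up x" "down x"
  shows False
proof -
  obtain n where n: "n \<in> fp_types" "n \<noteq> 0" "x = omega_mult n"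
    using assms(1) unfolding up_def by blast
  let ?m = "rev_ot n"
  have x: "x = n + omega_mult n" using n omega_mult_unfold by metis
  then have "rev_ot x = rev_ot (omega_mult n) + ?m" by (simp add: rev_ot_plus)
  moreover have "?m \<noteq> 0" using n(2) by (metis rev_ot_0 rev_ot_rev_ot)
  ultimately obtain q where "?m = omega_mult (q + rev_ot (omega_mult n))"
    using assms(2) up_suffix unfolding down_def by metis
  then have "?m = q + rev_ot (omega_mult n) + ?m"
    using omega_mult_unfold by metis
  then have "?m = q + (rev_ot (omega_mult n) + ?m) + ?m"
    using omega_mult_unfold[of n] rev_ot_plus by (metis add.assoc)
  then have "?m = (q + rev_ot (omega_mult n)) + ?m + ?m + 0"
    by (simp add: add.assoc)
  then have "?m = 0"
    using fp_types_no_doubling[OF fp_types_rev[OF n(1)]] unfolding no_doubling_def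
    by (metis add.left_neutral add.right_neutral)
  then show False using \<open>?m \<noteq> 0\<close> by contradiction
qed

text \<open>A period for the whole is assembled from the periods \<open>a + p\<close> of
  \<open>a + x\<close> and \<open>x + q\<close> of \<open>x + b\<close>.\<close>

lemma up_amalgam:
  assumes "up (a + x)" "up (x + b)" "x \<noteq> 0"
  shows "up (a + x + b)"
proof (cases "b = 0")
  case False
  obtain p where p: "a + p \<in> fp_types" "a + x = omega_mult (a + p)" "x = omega_mult (p + a)"
    using up_suffix[OF assms(1,3)] by metis
  obtain q where q: "x + q \<in> fp_types" "x + b = omega_mult (x + q)" "b = omega_mult (q + x)"
    using up_suffix[OF assms(2) False] by metis
  \<comment> \<open>Rotation moves the final \<open>p\<close> in front of the next
    \<open>a + x\<close>, where it is absorbed: \<open>p + a + x = x\<close>, because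
    \<open>x\<close> is \<open>omega_mult (p + a)\<close>. What remains is the period
    \<open>x + q\<close> of \<open>x + b\<close>.\<close>
  let ?k = "a + x + q + p"
  have "omega_mult ?k = a + x + q + omega_mult (p + (a + x + q))"
    by (rule omega_mult_plus)
  also have "p + (a + x + q) = x + q"
    using p(2,3) omega_mult_plus[of p a] by (metis add.assoc)
  also have "a + x + q + omega_mult (x + q) = a + x + omega_mult (q + x)"
    by (metis add.assoc omega_mult_plus)
  finally have "a + x + b = omega_mult ?k" using q(3) by simp
  moreover have "?k \<in> fp_types"
    using fp_types_plusD[OF p(1)] fp_types_plusD[OF q(1)] by (intro fp_types.plus)
  moreover have "?k \<noteq> 0"
    using assms(3) by (simp add: otype_plus_eq_0)
  ultimately show ?thesis unfolding up_def by blast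
qed (use assms in simp)

lemma down_prefix: "down (a + b) \<Longrightarrow> a \<noteq> 0 \<Longrightarrow> down a"
  unfolding down_def rev_ot_plus by (metis rev_ot_0 rev_ot_rev_ot up_suffix)

lemma down_amalgam:
  assumes "down (a + x)" "down (x + b)" "x \<noteq> 0"
  shows "down (a + x + b)"
  using assms up_amalgam[of "rev_ot b" "rev_ot x" "rev_ot a"]
  unfolding down_def rev_ot_plus by (metis add.assoc rev_ot_0 rev_ot_rev_ot)

section \<open>Decompositions into atoms without mergeable neighbours\<close>

abbreviation irreducible :: "otype list \<Rightarrow> bool" where
  "irreducible \<equiv> successively (\<lambda>a b. \<not> atom (a + b))"

lemma atom_cases_split:
  assumes "atom (a + b)" "a \<noteq> 0" "b \<noteq> 0"
  shows "up (a + b) \<or> down (a + b)"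
  using assms otype_plus_eq_1 unfolding atom_def by blast

text \<open>As a final segment of an \<omega>-atom, \<open>z\<close> is an \<omega>-atom. If it
  extends beyond the next entry \<open>y2\<close>, the induction continues with \<open>y2\<close> in
  place of \<open>y\<close>. If it ends strictly inside \<open>y2\<close>, then either
  \<open>y2\<close> is an \<omega>-atom and amalgamates with \<open>y + z\<close>, or it is an
  \<open>\<omega>\<^sup>*\<close>-atom and its initial segment \<open>z\<close> is of both kinds. If
  it ends with \<open>y2\<close>, then \<open>y + y2\<close> is the atom itself.\<close>

lemma no_up_overlap:
  assumes "irreducible (y # ys)" "\<forall>x\<in>set ys. atom x" "up (y + z)" "sum_list ys = z + w" "z \<noteq> 0"
  shows False
  using assms
proof (induction ys arbitrary: y z)
  case Nil
  then show ?case by (metis otype_plus_eq_0 sum_list.Nil)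
next
  case (Cons y2 ys)
  have y2: "atom y2" "\<not> atom (y + y2)" "y2 \<noteq> 0"
    using Cons.prems atom_neq_0 by auto
  have up_z: "up z" using up_suffix[OF Cons.prems(3,5)] by metis
  have "y2 + sum_list ys = z + w" using Cons.prems by simp
  then consider z' where "z = y2 + z'" "sum_list ys = z' + w" | r where "y2 = z + r"
    using otype_refine by blast
  then show ?case
  proof cases
    case (1 z')
    show ?thesis
    proof (cases "z' = 0")
      case True
      then show ?thesis using 1 Cons.prems y2 unfolding atom_def by simp
    next
      case False
      then show ?thesis
        using Cons.IH[of y2 z'] Cons.prems 1 up_z by auto
    qed
  next
    case (2 r)
    have "r \<noteq> 0"
      using 2 Cons.prems y2 unfolding atom_def by auto
    then consider "up y2" | "down y2"
      using atom_cases_split[of z r] 2 y2 Cons.prems by blast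
    then show ?thesis
    proof cases
      case 1
      then have "up (y + y2)"
        using up_amalgam[of y z r] 2 Cons.prems by (simp add: add.assoc)
      then show ?thesis using y2 unfolding atom_def by simp
    next
      case down: 2
      then have "down z" using down_prefix[of z r] 2 Cons.prems by simp
      then show ?thesis using not_up_down up_z by blast
    qed
  qed
qed

text \<open>The situation is that of two decompositions with first entries \<open>y + z\<close> and
  \<open>y\<close>, and tails \<open>xs\<close> and \<open>ys\<close>. By the preceding lemma
  \<open>y + z\<close> is an \<open>\<omega>\<^sup>*\<close>-atom. It ends strictly inside the entry
  \<open>y2\<close> after \<open>y\<close>, since otherwise \<open>y + y2\<close> would be one of
  its initial segments and hence an atom. Replacing \<open>y2\<close> by its remainder
  \<open>r\<close> gives a list with the same sum as \<open>xs\<close> and the same length as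
  \<open>ys\<close>, to which \<open>IH\<close> applies.\<close>

lemma irreducible_length_overlap:
  assumes IH: "\<And>ys'. length ys' = length ys \<Longrightarrow> irreducible ys' \<Longrightarrow> \<forall>x\<in>set ys'. atom x \<Longrightarrow>
      sum_list xs = sum_list ys' \<Longrightarrow> length xs = length ys'"
    and irr: "irreducible (y # ys)" and atoms: "\<forall>x\<in>set (y # ys). atom x" "atom (y + z)"
    and sum: "sum_list ys = z + sum_list xs" "z \<noteq> 0"
  shows "length xs = length ys"
proof -
  have y: "y \<noteq> 0" using atoms atom_neq_0 by simp
  have yz: "down (y + z)"
    using atom_cases_split[OF atoms(2) y sum(2)] no_up_overlap[OF irr] atoms sum by auto
  obtain y2 ys2 where ys: "ys = y2 # ys2"
    using sum otype_plus_eq_0 by (cases ys) auto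
  have y2: "atom y2" "\<not> atom (y + y2)" "y2 \<noteq> 0"
    using irr atoms atom_neq_0 unfolding ys by auto
  have "y2 + sum_list ys2 = z + sum_list xs" using sum ys by simp
  then consider z' where "z = y2 + z'" | r where "y2 = z + r" "sum_list xs = r + sum_list ys2"
    using otype_refine by blast
  then show ?thesis
  proof cases
    case (1 z')
    then have "down (y + y2)"
      using yz down_prefix[of "y + y2" z'] y by (simp add: add.assoc otype_plus_eq_0)
    then show ?thesis using y2 unfolding atom_def by simp
  next
    case (2 r)
    have r: "r \<noteq> 0"
      using 2 y2 yz unfolding atom_def by auto
    \<comment> \<open>The atoms \<open>y + z\<close> and \<open>y2 = z + r\<close> overlap in
      \<open>z\<close>, so two \<open>\<omega>\<^sup>*\<close>-atoms would amalgamate.\<close>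
    have not_down: "\<not> down y2"
    proof
      assume "down y2"
      then have "down (y + y2)"
        using down_amalgam[of y z r] yz 2 sum by (simp add: add.assoc)
      then show False using y2 unfolding atom_def by simp
    qed
    then have "up y2"
      using atom_cases_split[of z r] 2 y2 r sum by blast
    then have "up r" using up_suffix[of z r] r 2 by metis
    \<comment> \<open>The remainder \<open>r\<close> is an \<omega>-atom. If \<open>r + y3\<close>
      were one too, it would amalgamate with \<open>y2\<close> along \<open>r\<close>; if it were an
      \<open>\<omega>\<^sup>*\<close>-atom, its initial segment \<open>r\<close> would be of both
      kinds.\<close>
    have "irreducible (r # ys2)"
    proof (cases ys2)
      case (Cons y3 ys3)
      have y3: "\<not> atom (y2 + y3)" "irreducible ys2" "y3 \<noteq> 0"
        using irr atoms atom_neq_0 unfolding ys Cons by auto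
      have "\<not> atom (r + y3)"
      proof
        assume "atom (r + y3)"
        then consider "up (r + y3)" | "down (r + y3)"
          using atom_cases_split r y3 by blast
        then show False
        proof cases
          case 1
          then have "up (y2 + y3)"
            using up_amalgam[of z r y3] \<open>up y2\<close> 2 r by simp
          then show False using y3 unfolding atom_def by simp
        next
          case 2
          then show False using down_prefix r not_up_down \<open>up r\<close> by blast
        qed
      qed
      then show ?thesis using y3 Cons by simp
    qed simp
    moreover have "\<forall>x\<in>set (r # ys2). atom x"
      using atoms ys \<open>up r\<close> unfolding atom_def by simp
    ultimately show ?thesis
      using IH[of "r # ys2"] 2 ys by simp
  qed
qed

text \<open>Equal first entries are cancelled; otherwise one is a proper initial segment of the
  other and the overlap lemma compares the tails. The induction is on the total length because that
  lemma changes a tail but keeps its length.\<close>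

theorem irreducible_length_unique:
  assumes "irreducible xs" "irreducible ys" "\<forall>x\<in>set xs. atom x" "\<forall>x\<in>set ys. atom x"
    "sum_list xs = sum_list ys"
  shows "length xs = length ys"
  using assms
proof (induction "length xs + length ys" arbitrary: xs ys rule: less_induct)
  case less
  show ?case
  proof (cases "xs = [] \<or> ys = []")
    case True
    then show ?thesis
      using less.prems atom_neq_0 otype_plus_eq_0 by (cases xs; cases ys) auto
  next
    case False
    then obtain x xs' y ys' where xy: "xs = x # xs'" "ys = y # ys'"
      by (meson neq_Nil_conv)
    have irr': "irreducible xs'" "irreducible ys'"
      using less.prems unfolding xy by (auto simp: successively_Cons)
    have atoms': "\<forall>x\<in>set xs'. atom x" "\<forall>x\<in>set ys'. atom x"
      using less.prems unfolding xy by auto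
    have "x + sum_list xs' = y + sum_list ys'"
      using less.prems xy by simp
    then consider "x = y" "sum_list xs' = sum_list ys'"
      | z where "z \<noteq> 0" "x = y + z" "sum_list ys' = z + sum_list xs'"
      | z where "z \<noteq> 0" "y = x + z" "sum_list xs' = z + sum_list ys'"
      using otype_refine by (metis add.left_neutral add.right_neutral)
    then show ?thesis
    proof cases
      case 1
      then show ?thesis
        using less.hyps[of xs' ys'] irr' atoms' xy by simp
    next
      case (2 z)
      have "length xs' = length ys'"
      proof (rule irreducible_length_overlap[of ys' xs' y z])
        fix zs assume "length zs = length ys'" "irreducible zs" "\<forall>x\<in>set zs. atom x"
          "sum_list xs' = sum_list zs"
        then show "length xs' = length zs"
          using less.hyps[of xs' zs] irr' atoms' xy by simp
      qed (use less.prems 2 xy in auto)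
      then show ?thesis using xy by simp
    next
      case (3 z)
      have "length ys' = length xs'"
      proof (rule irreducible_length_overlap[of xs' ys' x z])
        fix zs assume "length zs = length xs'" "irreducible zs" "\<forall>x\<in>set zs. atom x"
          "sum_list ys' = sum_list zs"
        then show "length ys' = length zs"
          using less.hyps[of ys' zs] irr' atoms' xy by simp
      qed (use less.prems 3 xy in auto)
      then show ?thesis using xy by simp
    qed
  qed
qed

subsection \<open>Trees\<close>

fun sign_mult :: "sign \<Rightarrow> otype \<Rightarrow> otype" where
  "sign_mult Plus x = omega_mult x"
| "sign_mult Minus x = omega_rev_mult x"
| "sign_mult Zero x = x"

lemma ord_one_prod_iso:
  assumes "ctbl_order r"
  shows "ord_one \<times>\<^sub>o r \<cong>\<^sub>o r"
proof (rule order_isoI[where f = snd])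
  have "Field (ord_one \<times>\<^sub>o r) = {0} \<times> Field r"
    using Field_ordprod[OF ctbl_order_imp_Refl[OF ctbl_order_ord_one] ctbl_order_imp_Refl[OF assms]]
    by (simp add: Field_ord_one)
  then show "snd ` Field (ord_one \<times>\<^sub>o r) = Field r" by simp
  fix p q assume "(p, q) \<in> ord_one \<times>\<^sub>o r" "p \<noteq> q"
  then show "(snd p, snd q) \<in> r \<and> snd p \<noteq> snd q"
    by (cases p; cases q) (auto simp: mem_ordprod ord_one_def)
qed (use assms ctbl_order_ordprod ctbl_order_ord_one in blast)+

lemma ot_omega_pow_prod: "ctbl_order r \<Longrightarrow> ot (omega_pow g \<times>\<^sub>o r) = sign_mult g (ot r)"
  by (cases g) (simp_all add: ot_omega_mult ot_omega_rev omega_rev_mult_def ot_eqI[OF ord_one_prod_iso])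

lemma fp_nat_omega_pow_prod:
  assumes "fp_nat r"
  shows "fp_nat (enc (omega_pow g \<times>\<^sub>o r))"
proof (cases g)
  case Zero
  have "r \<cong>\<^sub>o enc (ord_one \<times>\<^sub>o r)"
    using ord_one_prod_iso[OF ctbl_order_fp_nat[OF assms]] order_iso_enc order_iso_trans order_iso_sym
    by blast
  then show ?thesis using Zero fp_nat.iso assms by simp
qed (simp_all add: fp_nat.omega fp_nat.omega_rev assms)

lemma fp_nat_LIN_at: "fp_nat (LIN_at T s \<sigma>)"
proof (induction T s \<sigma> rule: LIN_at.induct)
  case (1 T s \<sigma>)
  show ?case
  proof (cases "is_tree T \<and> \<sigma> \<in> T")
    case True
    have "fp_nat (if nchildren T \<sigma> = 0 then ord_one
        else enc (natsum {..<nchildren T \<sigma>} (\<lambda>x. LIN_at T s (\<sigma> @ [x]))))"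
      using 1 True by (auto intro: fp_nat.one fp_nat.sum)
    then show ?thesis
      using True fp_nat_omega_pow_prod by (subst LIN_at.simps) auto
  next
    case False
    then show ?thesis by (subst LIN_at.simps) (auto intro: fp_nat.zero)
  qed
qed

lemma ot_enc_natsum:
  assumes "\<And>x. x < n \<Longrightarrow> fp_nat (L x)"
  shows "ot (enc (natsum {..<n} L)) = sum_list (map (\<lambda>x. ot (L x)) [0..<n])"
  using ot_natsum[of 0 n L] assms ctbl_order_fp_nat by (simp add: ot_enc atLeast0LessThan)

lemma ot_LIN_at:
  assumes "is_tree T" "\<sigma> \<in> T"
  shows "ot (LIN_at T s \<sigma>) = sign_mult (s \<sigma>) (if nchildren T \<sigma> = 0 then 1
    else sum_list (map (\<lambda>x. ot (LIN_at T s (\<sigma> @ [x]))) [0..<nchildren T \<sigma>]))"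
proof -
  let ?X = "if nchildren T \<sigma> = 0 then ord_one
        else enc (natsum {..<nchildren T \<sigma>} (\<lambda>x. LIN_at T s (\<sigma> @ [x])))"
  have "fp_nat ?X"
    by (auto intro: fp_nat.one fp_nat.sum fp_nat_LIN_at)
  then have "ot (LIN_at T s \<sigma>) = sign_mult (s \<sigma>) (ot ?X)"
    using assms by (subst LIN_at.simps) (simp add: ot_enc ot_omega_pow_prod ctbl_order_fp_nat)
  also have "ot ?X = (if nchildren T \<sigma> = 0 then 1
    else sum_list (map (\<lambda>x. ot (LIN_at T s (\<sigma> @ [x]))) [0..<nchildren T \<sigma>]))"
    using ot_enc_natsum[OF fp_nat_LIN_at] by (simp add: one_otype_def)
  finally show ?thesis .
qed

lemma is_tree_Nil: "is_tree T \<Longrightarrow> [] \<in> T"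
  unfolding is_tree_def by (metis ex_in_conv prefix_bot.bot_least)

lemma card_tree_eq_1_iff:
  assumes "is_tree T"
  shows "card T = 1 \<longleftrightarrow> nchildren T [] = 0"
proof
  assume "card T = 1"
  then have "T = {[]}"
    using is_tree_Nil[OF assms] by (metis card_1_singletonE singletonD)
  then show "nchildren T [] = 0" by (simp add: nchildren_def)
next
  assume 0: "nchildren T [] = 0"
  have "\<tau> = []" if "\<tau> \<in> T" for \<tau>
  proof (rule ccontr)
    assume "\<tau> \<noteq> []"
    then have "prefix ([] @ [hd \<tau>]) \<tau>" by (cases \<tau>) auto
    then have "[] @ [hd \<tau>] \<in> T" using that assms unfolding is_tree_def by blast
    then show False
      using 0 assms is_tree_Nil[OF assms] unfolding is_tree_def by (metis not_less_zero)
  qed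
  then have "T = {[]}" using is_tree_Nil[OF assms] by blast
  then show "card T = 1" by simp
qed

text \<open>The special case for the one-node tree in \<open>LIN\<close> yields the empty sum
  \<open>0\<close> instead of \<open>1\<close>, so the formula holds for every number of
  children.\<close>

lemma ot_LIN:
  assumes "signed_tree3 T s"
  shows "ot (LIN T s) = sum_list (map (\<lambda>x. ot (LIN_at T s [x])) [0..<nchildren T []])"
proof -
  have T: "is_tree T" "[] \<in> T" "s [] = Zero"
    using assms is_tree_Nil unfolding signed_tree3_def by auto
  show ?thesis
    using T card_tree_eq_1_iff[OF T(1)] ot_LIN_at[OF T(1,2), of s]
    by (simp add: LIN_def ot_empty)
qed

lemma atom_sum_list_neq_0: "\<forall>x\<in>set xs. atom x \<Longrightarrow> xs \<noteq> [] \<Longrightarrow> sum_list xs \<noteq> 0"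
  using atom_neq_0 by (cases xs) (auto simp: otype_plus_eq_0)

lemma atom_sign_mult:
  assumes "g \<noteq> Zero" "x \<in> fp_types" "x \<noteq> 0"
  shows "atom (sign_mult g x)"
  using assms unfolding atom_def down_iff up_def by (cases g) auto

text \<open>A leaf has type \<open>1\<close>. An inner node other than the root has a sign different
  from \<open>Zero\<close>, applied to a nonempty sum of atoms.\<close>

lemma atom_LIN_at:
  assumes "signed_tree3 T s" "\<sigma> \<in> T" "\<sigma> \<noteq> []"
  shows "atom (ot (LIN_at T s \<sigma>))"
  using assms
proof (induction T s \<sigma> rule: LIN_at.induct)
  case (1 T s \<sigma>)
  have T: "is_tree T" using 1(2) unfolding signed_tree3_def by blast
  show ?case
  proof (cases "nchildren T \<sigma> = 0")
    case True
    then have "s \<sigma> = Zero" using "1.prems" unfolding signed_tree3_def by blast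
    then show ?thesis using True ot_LIN_at[OF T 1(3)] by (simp add: atom_def)
  next
    case False
    let ?xs = "map (\<lambda>x. ot (LIN_at T s (\<sigma> @ [x]))) [0..<nchildren T \<sigma>]"
    have "\<sigma> @ [x] \<in> T" if "x < nchildren T \<sigma>" for x
      using that T 1(3) unfolding is_tree_def by blast
    then have "\<forall>x\<in>set ?xs. atom x"
      using 1 T False by auto
    then have "sum_list ?xs \<noteq> 0"
      using False by (intro atom_sum_list_neq_0) auto
    moreover have "sum_list ?xs \<in> fp_types"
      by (rule sum_list_fp_types) (auto intro: fp_nat_fp_types fp_nat_LIN_at)
    moreover have "s \<sigma> \<noteq> Zero" using "1.prems" False by (auto simp: signed_tree3_def)
    ultimately show ?thesis
      using False ot_LIN_at[OF T 1(3), of s] atom_sign_mult by simp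
  qed
qed

section \<open>Joining trees under a common root\<close>

definition join_tree :: "nat \<Rightarrow> (nat \<Rightarrow> nat list set) \<Rightarrow> nat list set" where
  "join_tree k T = insert [] {i # \<sigma> | i \<sigma>. i < k \<and> \<sigma> \<in> T i}"

text \<open>The root sign is a parameter because the new root is an inner node in one application
  and the root of a 3-signed tree in the other.\<close>

definition join_sign :: "sign \<Rightarrow> (nat \<Rightarrow> nat list \<Rightarrow> sign) \<Rightarrow> nat list \<Rightarrow> sign" where
  "join_sign g s \<sigma> = (case \<sigma> of [] \<Rightarrow> g | i # \<tau> \<Rightarrow> s i \<tau>)"

context
  fixes k :: nat and T :: "nat \<Rightarrow> nat list set"
  assumes trees: "\<And>i. i < k \<Longrightarrow> is_tree (T i)"
begin

lemma mem_join_tree [simp]: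
  "[] \<in> join_tree k T" "i # \<sigma> \<in> join_tree k T \<longleftrightarrow> i < k \<and> \<sigma> \<in> T i"
  by (auto simp: join_tree_def)

lemma nchildren_join_tree_Nil [simp]: "nchildren (join_tree k T) [] = k"
proof -
  have "{x. [] @ [x] \<in> join_tree k T} = {..<k}"
    using trees is_tree_Nil by auto
  then show ?thesis by (simp add: nchildren_def)
qed

lemma nchildren_join_tree_Cons [simp]:
  "i < k \<Longrightarrow> nchildren (join_tree k T) (i # \<sigma>) = nchildren (T i) \<sigma>"
  by (simp add: nchildren_def)

lemma is_tree_join_tree: "is_tree (join_tree k T)"
proof -
  have "join_tree k T = insert [] (\<Union>i<k. (#) i ` T i)"
    by (auto simp: join_tree_def)
  then have "finite (join_tree k T)"
    using trees by (auto simp: is_tree_def)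
  moreover have "\<sigma> \<in> join_tree k T" if pre: "\<tau> \<in> join_tree k T" "prefix \<sigma> \<tau>" for \<sigma> \<tau>
  proof (cases \<sigma>)
    case (Cons i \<sigma>')
    then obtain \<tau>' where "\<tau> = i # \<tau>'" "prefix \<sigma>' \<tau>'"
      using pre(2) by (cases \<tau>) auto
    then show ?thesis
      using pre(1) trees Cons unfolding is_tree_def by auto
  qed simp
  moreover have "\<sigma> @ [x] \<in> join_tree k T \<longleftrightarrow> x < nchildren (join_tree k T) \<sigma>"
    if "\<sigma> \<in> join_tree k T" for \<sigma> x
  proof (cases \<sigma>)
    case Nil
    then show ?thesis using trees is_tree_Nil by auto
  next
    case (Cons i \<sigma>')
    then show ?thesis using that trees unfolding is_tree_def by auto
  qed
  moreover have "join_tree k T \<noteq> {}"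
    by (simp add: join_tree_def)
  ultimately show ?thesis
    unfolding is_tree_def by blast
qed

text \<open>The recursion at a node only consults the nodes below it, so the leading
  \<open>i\<close> is irrelevant.\<close>

lemma LIN_at_join_tree:
  assumes "i < k" "\<sigma> \<in> T i"
  shows "LIN_at (join_tree k T) (join_sign g s) (i # \<sigma>) = LIN_at (T i) (s i) \<sigma>"
  using assms(2)
proof (induction "T i" "s i" \<sigma> rule: LIN_at.induct)
  case (1 \<sigma>)
  have T: "is_tree (T i)" using trees assms(1) .
  let ?J = "join_tree k T" and ?s = "join_sign g s"
  have child: "LIN_at ?J ?s (i # \<sigma> @ [x]) = LIN_at (T i) (s i) (\<sigma> @ [x])"
    if "x < nchildren (T i) \<sigma>" for x
  proof -
    have "\<sigma> @ [x] \<in> T i" using that T 1(2) unfolding is_tree_def by blast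
    then show ?thesis using 1 T that by auto
  qed
  have "natsum {..<nchildren (T i) \<sigma>} (\<lambda>x. LIN_at ?J ?s (i # \<sigma> @ [x]))
      = natsum {..<nchildren (T i) \<sigma>} (\<lambda>x. LIN_at (T i) (s i) (\<sigma> @ [x]))"
    by (rule natsum_cong) (simp_all add: child)
  then show ?case
    using assms(1) 1(2) T is_tree_join_tree
    by (subst (1 2) LIN_at.simps) (simp add: join_sign_def)
qed

lemma ot_LIN_at_join_tree:
  assumes "k > 0"
  shows "ot (LIN_at (join_tree k T) (join_sign g s) []) =
    sign_mult g (sum_list (map (\<lambda>i. ot (LIN_at (T i) (s i) [])) [0..<k]))"
proof -
  have "map (\<lambda>i. ot (LIN_at (join_tree k T) (join_sign g s) ([] @ [i]))) [0..<k] =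
      map (\<lambda>i. ot (LIN_at (T i) (s i) [])) [0..<k]"
    using trees is_tree_Nil by (auto simp: LIN_at_join_tree)
  then show ?thesis
    using assms unfolding ot_LIN_at[OF is_tree_join_tree mem_join_tree(1)]
    by (simp add: join_sign_def del: map_eq_conv)
qed

end

text \<open>Unlike in \<^const>\<open>signed_tree3\<close>, the root carries a sign unless it is a leaf, because it
  is going to be an inner node.\<close>

definition realizes :: "nat list set \<Rightarrow> (nat list \<Rightarrow> sign) \<Rightarrow> otype \<Rightarrow> bool" where
  "realizes T s x \<longleftrightarrow> is_tree T \<and> (\<forall>\<sigma>\<in>T. s \<sigma> = Zero \<longleftrightarrow> nchildren T \<sigma> = 0)
     \<and> x = ot (LIN_at T s [])"

lemma realizes_one: "\<exists>T s. realizes T s 1"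
proof -
  have "is_tree {[]}" "nchildren {[]} [] = 0"
    by (auto simp: is_tree_def nchildren_def)
  then have "realizes {[]} (\<lambda>_. Zero) 1"
    using ot_LIN_at[of "{[]}" "[]" "\<lambda>_. Zero"] by (simp add: realizes_def)
  then show ?thesis by blast
qed

text \<open>The realizing trees are joined under a root of sign \<open>g\<close>. As
  \<open>xs\<close> is nonempty, this root is an inner node, as a sign other than
  \<open>Zero\<close> requires.\<close>

lemma realizes_sign_mult:
  assumes "\<forall>x\<in>set xs. \<exists>T s. realizes T s x" "xs \<noteq> []" "g \<noteq> Zero"
  shows "\<exists>T s. realizes T s (sign_mult g (sum_list xs))"
proof -
  have "\<forall>i. \<exists>T s. i < length xs \<longrightarrow> realizes T s (xs ! i)"
    using assms(1) by auto
  then obtain T s where Ts: "\<And>i. i < length xs \<Longrightarrow> realizes (T i) (s i) (xs ! i)"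
    by metis
  let ?k = "length xs"
  have trees: "\<And>i. i < ?k \<Longrightarrow> is_tree (T i)"
    using Ts unfolding realizes_def by blast
  have "map (\<lambda>i. ot (LIN_at (T i) (s i) [])) [0..<?k] = xs"
    using Ts by (intro nth_equalityI) (auto simp: realizes_def)
  then have "ot (LIN_at (join_tree ?k T) (join_sign g s) []) = sign_mult g (sum_list xs)"
    using ot_LIN_at_join_tree[of ?k T g s, OF trees] assms(2) by simp
  moreover have "join_sign g s \<sigma> = Zero \<longleftrightarrow> nchildren (join_tree ?k T) \<sigma> = 0"
    if "\<sigma> \<in> join_tree ?k T" for \<sigma>
    using that assms(2,3) trees Ts
    by (cases \<sigma>) (auto simp: join_sign_def realizes_def nchildren_join_tree_Nil[of ?k T, OF trees]
      nchildren_join_tree_Cons[of ?k T, OF trees] mem_join_tree[of ?k T, OF trees])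
  ultimately have "realizes (join_tree ?k T) (join_sign g s) (sign_mult g (sum_list xs))"
    using is_tree_join_tree[of ?k T, OF trees] unfolding realizes_def by simp
  then show ?thesis by blast
qed

text \<open>The decomposition and the realizing trees are obtained together: a tree for a multiple
  of \<open>a\<close> is built from trees for the atoms that \<open>a\<close> is the sum of. The
  multiples of \<open>0\<close> yield the empty list.\<close>

lemma fp_types_sum_atoms:
  "x \<in> fp_types \<Longrightarrow> \<exists>xs. (\<forall>y\<in>set xs. atom y \<and> (\<exists>T s. realizes T s y)) \<and> x = sum_list xs"
proof (induction rule: fp_types.induct)
  case zero
  show ?case by (rule exI[of _ "[]"]) simp
next
  case one
  show ?case by (rule exI[of _ "[1]"]) (simp add: atom_def realizes_one)
next
  case (plus a b)
  then show ?case by (metis Un_iff set_append sum_list_append)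
next
  case (omega_mult a)
  show ?case
  proof (cases "a = 0")
    case True
    then show ?thesis by (intro exI[of _ "[]"]) simp
  next
    case False
    then have "\<exists>T s. realizes T s (sign_mult Plus a)"
      using omega_mult.IH realizes_sign_mult by (metis sign.distinct(3) sum_list.Nil)
    then show ?thesis
      using atom_sign_mult[of Plus a] omega_mult.hyps False by (intro exI[of _ "[omega_mult a]"]) simp
  qed
next
  case (omega_rev_mult a)
  show ?case
  proof (cases "a = 0")
    case True
    then show ?thesis by (intro exI[of _ "[]"]) (simp add: omega_rev_mult_def)
  next
    case False
    then have "\<exists>T s. realizes T s (sign_mult Minus a)"
      using omega_rev_mult.IH realizes_sign_mult by (metis sign.distinct(5) sum_list.Nil)
    then show ?thesis
      using atom_sign_mult[of Minus a] omega_rev_mult.hyps False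
      by (intro exI[of _ "[omega_rev_mult a]"]) simp
  qed
qed

lemma atom_realizes:
  assumes "atom x"
  shows "\<exists>T s. realizes T s x"
proof -
  consider "x = 1" | n where "n \<in> fp_types" "n \<noteq> 0" "x = sign_mult Plus n"
    | n where "n \<in> fp_types" "n \<noteq> 0" "x = sign_mult Minus n"
    using assms unfolding atom_def down_iff up_def by auto
  then show ?thesis
    using realizes_one realizes_sign_mult fp_types_sum_atoms
    by cases (blast, (metis sign.distinct sum_list.Nil)+)
qed

text \<open>Here the common root gets sign \<open>Zero\<close>. For the empty list the construction
  gives the one-node tree, of type \<open>0\<close>.\<close>

lemma tree_of_atoms:
  assumes "\<forall>x\<in>set xs. atom x"
  shows "\<exists>T s. signed_tree3 T s \<and> nchildren T [] = length xs \<and> ot (LIN T s) = sum_list xs"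
proof -
  let ?k = "length xs"
  have "\<forall>i. \<exists>T s. i < ?k \<longrightarrow> realizes T s (xs ! i)"
    using assms atom_realizes by (metis nth_mem)
  then obtain T s where Ts: "\<And>i. i < ?k \<Longrightarrow> realizes (T i) (s i) (xs ! i)"
    by metis
  have trees: "\<And>i. i < ?k \<Longrightarrow> is_tree (T i)"
    using Ts unfolding realizes_def by blast
  let ?T = "join_tree ?k T" and ?s = "join_sign Zero s"
  have "?s \<sigma> = Zero \<longleftrightarrow> \<sigma> = [] \<or> nchildren ?T \<sigma> = 0" if "\<sigma> \<in> ?T" for \<sigma>
    using that trees Ts
    by (cases \<sigma>) (auto simp: join_sign_def realizes_def
      nchildren_join_tree_Cons[of ?k T, OF trees] mem_join_tree[of ?k T, OF trees])
  then have tree: "signed_tree3 ?T ?s"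
    using is_tree_join_tree[of ?k T, OF trees] by (simp add: signed_tree3_def)
  have n: "nchildren ?T [] = ?k"
    by (rule nchildren_join_tree_Nil[of ?k T, OF trees])
  have "map (\<lambda>i. ot (LIN_at ?T ?s [i])) [0..<?k] = xs"
    using Ts trees is_tree_Nil
    by (intro nth_equalityI) (auto simp: realizes_def LIN_at_join_tree[of ?k T, OF trees])
  then show ?thesis
    using tree n ot_LIN[OF tree] by (intro exI[of _ ?T] exI[of _ ?s]) simp
qed

section \<open>Width as the least number of atoms\<close>

text \<open>The children of the root contribute one atom each, and conversely any list of atoms is
  realized by a tree. From here on trees no longer occur.\<close>

lemma wd_eq:
  assumes "ctbl_order r"
  shows "wd r = (LEAST k. \<exists>xs. (\<forall>x\<in>set xs. atom x) \<and> sum_list xs = ot r \<and> length xs = k)"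
proof -
  have "(\<exists>T s. signed_tree3 T s \<and> LIN T s \<cong>\<^sub>o r \<and> k = nchildren T []) \<longleftrightarrow>
      (\<exists>xs. (\<forall>x\<in>set xs. atom x) \<and> sum_list xs = ot r \<and> length xs = k)" for k
  proof (intro iffI; elim exE conjE)
    fix T s assume T: "signed_tree3 T s" "LIN T s \<cong>\<^sub>o r" "k = nchildren T []"
    let ?xs = "map (\<lambda>x. ot (LIN_at T s [x])) [0..<k]"
    have "[] @ [x] \<in> T" if "x < k" for x
      using that T is_tree_Nil unfolding signed_tree3_def is_tree_def by blast
    then have "\<forall>x\<in>set ?xs. atom x"
      using atom_LIN_at[OF T(1)] by auto
    moreover have "sum_list ?xs = ot r"
      using ot_LIN[OF T(1)] ot_eqI[OF T(2)] T(3) by simp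
    ultimately show "\<exists>xs. (\<forall>x\<in>set xs. atom x) \<and> sum_list xs = ot r \<and> length xs = k"
      by (intro exI[of _ ?xs]) simp
  next
    fix xs assume xs: "\<forall>x\<in>set xs. atom x" "sum_list xs = ot r" "length xs = k"
    obtain T s where T: "signed_tree3 T s" "nchildren T [] = k" "ot (LIN T s) = ot r"
      using tree_of_atoms[OF xs(1)] xs(2,3) by metis
    have "fp_nat (LIN T s)"
      unfolding LIN_def using fp_nat.zero fp_nat_LIN_at by simp
    then have "LIN T s \<cong>\<^sub>o r"
      using ot_eqD[OF T(3)] ctbl_order_fp_nat assms by blast
    then show "\<exists>T s. signed_tree3 T s \<and> LIN T s \<cong>\<^sub>o r \<and> k = nchildren T []"
      using T by blast
  qed
  then show ?thesis unfolding wd_def by simp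
qed

lemma finitely_presented_ot:
  assumes "finitely_presented r"
  shows "ctbl_order r" "ot r \<in> fp_types"
proof -
  obtain s where s: "fp_nat s" "s \<cong>\<^sub>o r"
    using assms unfolding finitely_presented_def by blast
  show "ctbl_order r" using ctbl_order_iso[OF ctbl_order_fp_nat[OF s(1)] s(2)] .
  show "ot r \<in> fp_types" using fp_nat_fp_types[OF s(1)] ot_eqI[OF s(2)] by simp
qed

lemma wd_obtain:
  assumes "ctbl_order r" "ot r \<in> fp_types"
  obtains xs where "\<forall>x\<in>set xs. atom x" "sum_list xs = ot r" "length xs = wd r"
    "\<And>ys. \<forall>y\<in>set ys. atom y \<Longrightarrow> sum_list ys = ot r \<Longrightarrow> wd r \<le> length ys"
proof -
  let ?P = "\<lambda>k. \<exists>xs. (\<forall>x\<in>set xs. atom x) \<and> sum_list xs = ot r \<and> length xs = k"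
  obtain xs where "\<forall>x\<in>set xs. atom x" "ot r = sum_list xs"
    using fp_types_sum_atoms[OF assms(2)] by blast
  then have "?P (length xs)" by auto
  then have "?P (wd r)" unfolding wd_eq[OF assms(1)] by (rule LeastI)
  moreover have "wd r \<le> length ys" if "\<forall>y\<in>set ys. atom y" "sum_list ys = ot r" for ys
    unfolding wd_eq[OF assms(1)] by (rule Least_le) (use that in blast)
  ultimately show thesis using that by blast
qed

text \<open>In a decomposition of least length, merging two neighbours whose sum is an atom would
  give a shorter one. So it is irreducible as well, and uniqueness of the length applies.\<close>

lemma wd_irreducible:
  assumes "ctbl_order r" "irreducible xs" "\<forall>x\<in>set xs. atom x" "xs \<noteq> []"
    "sum_list xs = ot r" "ot r \<in> fp_types"
  shows "wd r = length xs"
proof -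
  obtain ys where ys: "\<forall>y\<in>set ys. atom y" "sum_list ys = ot r" "length ys = wd r"
    and least: "\<And>zs. \<forall>z\<in>set zs. atom z \<Longrightarrow> sum_list zs = ot r \<Longrightarrow> wd r \<le> length zs"
    using wd_obtain[OF assms(1,6)] by metis
  have "irreducible ys"
    unfolding successively_conv_nth
  proof (intro allI impI notI)
    fix i assume i: "Suc i < length ys" and atom: "atom (ys ! i + ys ! Suc i)"
    let ?zs = "take i ys @ (ys ! i + ys ! Suc i) # drop (Suc (Suc i)) ys"
    have eq: "ys = take i ys @ ys ! i # ys ! Suc i # drop (Suc (Suc i)) ys"
      using i by (simp add: Cons_nth_drop_Suc id_take_nth_drop[of i ys, symmetric])
    have "sum_list ?zs = ot r"
      using ys(2) arg_cong[OF eq, of sum_list] by (simp add: add.assoc)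
    moreover have "\<forall>z\<in>set ?zs. atom z"
      using ys(1) atom by (auto dest: in_set_takeD in_set_dropD)
    ultimately show False
      using least[of ?zs] ys(3) i by simp
  qed
  then show ?thesis
    using irreducible_length_unique[OF assms(2) _ assms(3)] ys assms(5) by metis
qed

theorem theorem8p6:
  fixes n :: nat and L :: "nat \<Rightarrow> 'a rel"
  assumes "n > 1"
    and "\<And>i. 1 \<le> i \<Longrightarrow> i \<le> n \<Longrightarrow> finitely_presented (L i)"
    and "\<And>i. 1 \<le> i \<Longrightarrow> i \<le> n \<Longrightarrow> wd (L i) = 1"
    and "\<And>i. 1 \<le> i \<Longrightarrow> i < n \<Longrightarrow> wd (natsum {i..i + 1} L) = 2"
  shows "wd (natsum {1..n} L) = n"
proof -
  have fp: "ctbl_order (L i)" "ot (L i) \<in> fp_types" if "1 \<le> i" "i \<le> n" for i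
    using assms(2)[OF that] finitely_presented_ot by blast+
  have atoms: "atom (ot (L i))" if i: "1 \<le> i" "i \<le> n" for i
  proof -
    obtain xs where xs: "\<forall>x\<in>set xs. atom x" "sum_list xs = ot (L i)" "length xs = wd (L i)"
      using wd_obtain[OF fp(1)[OF i] fp(2)[OF i]] by metis
    then obtain x where "xs = [x]"
      using assms(3)[OF i] by (cases xs) auto
    then show ?thesis using xs by simp
  qed
  have ot_sum: "ot (natsum {a..b} L) = sum_list (map (\<lambda>i. ot (L i)) [a..<Suc b])"
      "ctbl_order (natsum {a..b} L)" "ot (natsum {a..b} L) \<in> fp_types"
    if "1 \<le> a" "b \<le> n" for a b
  proof -
    show eq: "ot (natsum {a..b} L) = sum_list (map (\<lambda>i. ot (L i)) [a..<Suc b])"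
      using ot_natsum[of a "Suc b" L] fp that by (simp add: atLeastLessThanSuc_atLeastAtMost)
    show "ctbl_order (natsum {a..b} L)" using fp that by (intro ctbl_order_natsum) auto
    show "ot (natsum {a..b} L) \<in> fp_types"
      unfolding eq using fp that by (intro sum_list_fp_types) auto
  qed
  have no_merge: "\<not> atom (ot (L i) + ot (L (Suc i)))" if "1 \<le> i" "i < n" for i
  proof
    assume atom: "atom (ot (L i) + ot (L (Suc i)))"
    have "ot (natsum {i..i + 1} L) = ot (L i) + ot (L (Suc i))"
      using ot_sum(1)[of i "i + 1"] that by simp
    \<comment> \<open>A one-element list is irreducible, so an atomic sum would have width 1,
      against the hypothesis on neighbouring summands.\<close>
    then have "wd (natsum {i..i + 1} L) = 1"
      using wd_irreducible[of "natsum {i..i + 1} L" "[ot (L i) + ot (L (Suc i))]"]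
        ot_sum[of i "i + 1"] atom that by simp
    then show False using assms(4)[OF that] by simp
  qed
  let ?xs = "map (\<lambda>i. ot (L i)) [1..<Suc n]"
  have "irreducible ?xs"
    unfolding successively_conv_nth using no_merge by (auto simp del: upt_Suc)
  moreover have "\<forall>x\<in>set ?xs. atom x" using atoms by auto
  ultimately have "wd (natsum {1..n} L) = length ?xs"
    using wd_irreducible[of "natsum {1..n} L" ?xs] ot_sum[of 1 n] assms(1) by simp
  then show ?thesis by simp
qed

end
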